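(* Let $X$ be an infinite compact metrizable space and $h\colon X\to X$ a minimal homeomorphism. If $(X,h)$ has the topological small boundary property, then $(X,h)$ has the dynamic comparison property.
   Context: $M_h(X)$ denotes the set of $h$-invariant Borel probability measures on $X$. A Borel set $E\subset X$ is universally null if $\mu(E)=0$ for all $\mu\in M_h(X)$. $\partial A$ denotes the topological boundary of $A\subset X$. A closed set $F\subset X$ is topologically $h$-small if there is $m\in\mathbb{Z}_{+}$ such that whenever $d(0),\dots,d(m)$ are $m+1$ distinct integers, $h^{d(0)}(F)\cap\cdots\cap h^{d(m)}(F)=\varnothing$. $(X,h)$ has the topological small boundary property if whenever $F,K\subset X$ are disjoint compact sets, there exist open sets $U,V\subset X$ with $F\subset U$, $K\subset V$, $\overline{U}\cap\overline{V}=\varnothing$ and $\partial U$ topologically $h$-small. $(X,h)$ has the dynamic comparison property if whenever $U\subset X$ is open and $C\subset X$ is closed with $\partial C,\partial U$ universally null and $\mu(C)<\mu(U)$ for every $\mu\in M_h(X)$, there exist $M\in\mathbb{N}$, continuous functions $f_j\colon X\to[0,1]$ ($0\le j\le M$) and integers $d(0),\dots,d(M)$ such that $\sum_{j=0}^M f_j=1$ on $C$ and the sets $\mathrm{supp}(f_j\circ h^{-d(j)})$, $0\le j\le M$, are pairwise disjoint subsets of $U$. *)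

theory Defs
  imports "HOL-Analysis.Analysis" "HOL-Probability.Probability"
begin

definition hpow :: "('a \<Rightarrow> 'a) \<Rightarrow> int \<Rightarrow> 'a \<Rightarrow> 'a" where
  "hpow h d = (if d \<ge> 0 then h ^^ nat d else (inv h) ^^ nat (- d))"

definition minimal_hom :: "('a::topological_space \<Rightarrow> 'a) \<Rightarrow> bool" where
  "minimal_hom h \<longleftrightarrow> (\<forall>Y. closed Y \<and> Y \<noteq> {} \<and> h ` Y = Y \<longrightarrow> Y = UNIV)"

definition inv_measures :: "('a::topological_space \<Rightarrow> 'a) \<Rightarrow> 'a measure set" where
  "inv_measures h = {\<mu>. sets \<mu> = sets borel \<and> prob_space \<mu> \<and>
       (\<forall>A\<in>sets borel. emeasure \<mu> (h -` A) = emeasure \<mu> A)}"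

definition universally_null :: "('a::topological_space \<Rightarrow> 'a) \<Rightarrow> 'a set \<Rightarrow> bool" where
  "universally_null h E \<longleftrightarrow> E \<in> sets borel \<and> (\<forall>\<mu>\<in>inv_measures h. emeasure \<mu> E = 0)"

definition top_small :: "('a::topological_space \<Rightarrow> 'a) \<Rightarrow> 'a set \<Rightarrow> bool" where
  "top_small h F \<longleftrightarrow> closed F \<and>
     (\<exists>m::nat. m > 0 \<and> (\<forall>d::nat \<Rightarrow> int. inj_on d {0..m} \<longrightarrow>
        (\<Inter>j\<in>{0..m}. hpow h (d j) ` F) = {}))"

definition top_small_boundary_property :: "('a::topological_space \<Rightarrow> 'a) \<Rightarrow> bool" where
  "top_small_boundary_property h \<longleftrightarrow>
     (\<forall>F K. compact F \<and> compact K \<and> F \<inter> K = {} \<longrightarrow>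
        (\<exists>U V. open U \<and> open V \<and> F \<subseteq> U \<and> K \<subseteq> V \<and>
               closure U \<inter> closure V = {} \<and> top_small h (frontier U)))"

definition supp_fun :: "('a::topological_space \<Rightarrow> real) \<Rightarrow> 'a set" where
  "supp_fun f = closure {x. f x \<noteq> 0}"

definition dynamic_comparison_property :: "('a::topological_space \<Rightarrow> 'a) \<Rightarrow> bool" where
  "dynamic_comparison_property h \<longleftrightarrow>
     (\<forall>U C. open U \<and> closed C \<and> universally_null h (frontier C) \<and>
            universally_null h (frontier U) \<and>
            (\<forall>\<mu>\<in>inv_measures h. emeasure \<mu> C < emeasure \<mu> U) \<longrightarrow>
        (\<exists>(M::nat) (f::nat \<Rightarrow> 'a \<Rightarrow> real) (d::nat \<Rightarrow> int).
            (\<forall>j\<le>M. continuous_on UNIV (f j) \<and> (\<forall>x. 0 \<le> f j x \<and> f j x \<le> 1)) \<and>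
            (\<forall>x\<in>C. (\<Sum>j\<le>M. f j x) = 1) \<and>
            (\<forall>j\<le>M. supp_fun (f j \<circ> hpow h (- d j)) \<subseteq> U) \<and>
            (\<forall>j\<le>M. \<forall>k\<le>M. j \<noteq> k \<longrightarrow>
               supp_fun (f j \<circ> hpow h (- d j)) \<inter> supp_fun (f k \<circ> hpow h (- d k)) = {})))"

end

theory Submission
  imports Defs
begin

text \<open>
  If \<open>\<mu>(C) < \<mu>(U)\<close> for all invariant \<open>\<mu>\<close>, then a Krylov--Bogoliubov argument gives a neighbourhood
  \<open>A\<close> of \<open>C\<close> and a set \<open>B\<close> with closure in \<open>U\<close> such that every sufficiently long orbit segment visits
  \<open>B\<close> at least as often as \<open>A\<close>; both can be chosen with topologically small boundary.  Cutting the orbits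
  at the visits to a small open set \<open>Y\<close> with long return times and small boundary, one matches the
  points of \<open>A\<close> injectively with points of \<open>B\<close> block by block.  The matching depends on a bounded part of
  the itinerary, so it moves finitely many pieces of \<open>A\<close> by fixed powers of \<open>h\<close>, and the boundaries of
  these pieces lie in a topologically small closed set \<open>F\<close>.  A neighbourhood of \<open>F\<close> is moved
  separately into a nonempty open part of \<open>U\<close> kept away from \<open>B\<close>.
\<close>

subsection \<open>Measures from finitely additive set functions\<close>

text \<open>In a Cantor set the pieces could be taken clopen and the matching would already finish
  the proof. In general they are only locally constant off \<open>F\<close>: their images are
  disjoint, but the images of their closures may meet, whereas comparison asks for disjoint closed
  supports. Thus the difficulty is concentrated on \<open>F\<close>. Smallness bounds the number of
  visits of an orbit to \<open>F\<close>, and induction on this bound fits \<open>F\<close> into any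
  nonempty open set. The open set chosen must not compete with the targets of the matching; the gap
  between \<open>B\<close> and \<open>U\<close> is bought by removing from \<open>U\<close> one
  point, which has no mass. Visits may compare wrongly on short windows, hence the long blocks;
  minimality bounds their length from above and so keeps the number of pieces finite. Limits are
  taken of functions on all subsets, where Tychonoff's theorem gives compactness at once; countable
  additivity is restored only afterwards, by approximation with compact sets from inside and open
  sets from outside.\<close>

locale finitely_additive =
  fixes lam :: "'a::metric_space set \<Rightarrow> ennreal"
  assumes lam_UNIV: "lam UNIV = 1"
    and lam_Un: "\<And>A B. A \<inter> B = {} \<Longrightarrow> lam (A \<union> B) = lam A + lam B"
begin

lemma lam_mono: "A \<subseteq> B \<Longrightarrow> lam A \<le> lam B"
proof -
  assume "A \<subseteq> B"
  then have "lam B = lam A + lam (B - A)"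
    using lam_Un[of A "B - A"] by (simp add: Un_absorb1)
  then show ?thesis by simp
qed

lemma lam_le_1: "lam A \<le> 1"
  using lam_mono[of A UNIV] lam_UNIV by simp

lemma lam_empty: "lam {} = 0"
proof -
  have "lam {} + lam {} = lam {} + 0" using lam_Un[of "{}" "{}"] by simp
  moreover have "lam {} \<noteq> top" using lam_le_1[of "{}"] by (auto simp: top_unique)
  ultimately show ?thesis unfolding ennreal_add_left_cancel by (auto simp: infinity_ennreal_def)
qed

lemma lam_subadd: "lam (A \<union> B) \<le> lam A + lam B"
proof -
  have "lam (A \<union> B) = lam A + lam (B - A)" using lam_Un[of A "B - A"] by simp
  also have "\<dots> \<le> lam A + lam B" by (intro add_left_mono lam_mono) auto
  finally show ?thesis .
qed

lemma lam_UN_le: "finite I \<Longrightarrow> lam (\<Union>i\<in>I. A i) \<le> (\<Sum>i\<in>I. lam (A i))"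
proof (induction I rule: finite_induct)
  case (insert i I)
  have "lam (\<Union>i\<in>insert i I. A i) \<le> lam (A i) + lam (\<Union>i\<in>I. A i)"
    using lam_subadd by simp
  also have "\<dots> \<le> lam (A i) + (\<Sum>i\<in>I. lam (A i))" using insert by (intro add_left_mono) auto
  finally show ?case using insert by simp
qed (simp add: lam_empty)

text \<open>On an open set \<open>lam\<close> itself may exceed this supremum. Approximation by
  compact sets is what makes countable subadditivity available, because countable covers of compact
  sets reduce to finite ones.\<close>

definition inner_content :: "'a set \<Rightarrow> ennreal" where
  "inner_content G = (SUP K\<in>{K. compact K \<and> K \<subseteq> G}. lam K)"

definition outer_content :: "'a set \<Rightarrow> ennreal" where
  "outer_content A = (INF G\<in>{G. open G \<and> A \<subseteq> G}. inner_content G)"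

lemma lam_le_inner: "compact K \<Longrightarrow> K \<subseteq> G \<Longrightarrow> lam K \<le> inner_content G"
  unfolding inner_content_def by (rule SUP_upper) simp

lemma inner_mono: "G \<subseteq> H \<Longrightarrow> inner_content G \<le> inner_content H"
  unfolding inner_content_def by (rule SUP_subset_mono) auto

lemma inner_le_1: "inner_content G \<le> 1"
  unfolding inner_content_def by (rule SUP_least) (rule lam_le_1)

lemma outer_mono: "A \<subseteq> B \<Longrightarrow> outer_content A \<le> outer_content B"
  unfolding outer_content_def by (rule INF_superset_mono) auto

lemma outer_le_inner: "open G \<Longrightarrow> A \<subseteq> G \<Longrightarrow> outer_content A \<le> inner_content G"
  unfolding outer_content_def by (rule INF_lower) simp

lemma outer_open: "open G \<Longrightarrow> outer_content G = inner_content G"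
proof (rule antisym)
  show "inner_content G \<le> outer_content G"
    unfolding outer_content_def by (auto intro!: INF_greatest inner_mono)
qed (simp add: outer_le_inner)

text \<open>A compact subset of the union is cut, by a finite subcover with small balls, into
  finitely many compact pieces, each inside a single \<open>G i\<close>; finite subadditivity of
  \<open>lam\<close> then suffices.\<close>

lemma inner_UN_le:
  fixes G :: "nat \<Rightarrow> 'a set"
  assumes "\<And>i. open (G i)"
  shows "inner_content (\<Union>i. G i) \<le> (\<Sum>i. inner_content (G i))"
  unfolding inner_content_def[of "\<Union>i. G i"]
proof (rule SUP_least, safe)
  fix K assume K: "compact K" "K \<subseteq> (\<Union>i. G i)"
  have "\<exists>i e. 0 < e \<and> cball x e \<subseteq> G i" if "x \<in> K" for x
    using K(2) that assms open_contains_cball by blast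
  then obtain n r where nr: "\<And>x. x \<in> K \<Longrightarrow> 0 < r x" "\<And>x. x \<in> K \<Longrightarrow> cball x (r x) \<subseteq> G (n x)"
    by metis
  have "K \<subseteq> (\<Union>x\<in>K. ball x (r x))" using nr(1) by force
  then obtain P where P: "P \<subseteq> K" "finite P" "K \<subseteq> (\<Union>x\<in>P. ball x (r x))"
    using compactE_image[OF K(1), of K "\<lambda>x. ball x (r x)"] by blast
  define L where "L i = K \<inter> (\<Union>x\<in>{x \<in> P. n x = i}. cball x (r x))" for i
  have "compact (L i)" for i
    unfolding L_def using P(2) K(1) by (intro compact_Int_closed closed_UN) auto
  moreover have "L i \<subseteq> G i" for i using nr(2) P(1) unfolding L_def by blast
  ultimately have L: "lam (L i) \<le> inner_content (G i)" for i by (intro lam_le_inner)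
  have "K \<subseteq> (\<Union>i\<in>n ` P. L i)" using P(3) by (force simp: L_def)
  then have "lam K \<le> lam (\<Union>i\<in>n ` P. L i)" by (rule lam_mono)
  also have "\<dots> \<le> (\<Sum>i\<in>n ` P. lam (L i))" using P(2) by (intro lam_UN_le) auto
  also have "\<dots> \<le> (\<Sum>i\<in>n ` P. inner_content (G i))" by (intro sum_mono L)
  also have "\<dots> \<le> (\<Sum>i. inner_content (G i))" using P(2) by (intro sum_le_suminf) auto
  finally show "lam K \<le> (\<Sum>i. inner_content (G i))" .
qed

lemma outer_UN_le:
  fixes A :: "nat \<Rightarrow> 'a set"
  shows "outer_content (\<Union>i. A i) \<le> (\<Sum>i. outer_content (A i))"
proof (rule ennreal_le_epsilon)
  fix e :: real assume e: "0 < e"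
  have "\<exists>G. open G \<and> A n \<subseteq> G \<and> inner_content G \<le> outer_content (A n) + e * (1/2) ^ Suc n" for n
  proof -
    have "outer_content (A n) \<le> 1"
      using outer_le_inner[of UNIV "A n"] inner_le_1[of UNIV] by auto
    then have "outer_content (A n) \<noteq> top" by (auto simp: top_unique)
    then have "outer_content (A n) < outer_content (A n) + e * (1/2) ^ Suc n"
      using e by (auto simp: less_top)
    then obtain G where "open G" "A n \<subseteq> G" "inner_content G < outer_content (A n) + e * (1/2) ^ Suc n"
      unfolding outer_content_def[of "A n"] INF_less_iff by blast
    then show ?thesis by (intro exI[of _ G]) (auto simp: less_imp_le)
  qed
  then obtain G where G: "\<And>n. open (G n)" "\<And>n. A n \<subseteq> G n"
    "\<And>n. inner_content (G n) \<le> outer_content (A n) + e * (1/2) ^ Suc n" by metis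
  have "outer_content (\<Union>i. A i) \<le> inner_content (\<Union>i. G i)"
    using G(1,2) by (intro outer_le_inner open_UN UN_mono) auto
  also have "\<dots> \<le> (\<Sum>i. inner_content (G i))" using G(1) by (rule inner_UN_le)
  also have "\<dots> \<le> (\<Sum>n. outer_content (A n) + e * (1/2) ^ Suc n)"
    using G(3) by (intro suminf_le) auto
  also have "\<dots> = (\<Sum>n. outer_content (A n)) + (\<Sum>n. ennreal e * ennreal ((1/2) ^ Suc n))"
    using e by (subst suminf_add[symmetric])
      (auto simp del: ennreal_suminf_cmult simp add: ennreal_mult[symmetric])
  also have "\<dots> = (\<Sum>n. outer_content (A n)) + e"
    unfolding ennreal_suminf_cmult
    by (subst suminf_ennreal_eq[OF zero_le_power power_half_series]) auto
  finally show "outer_content (\<Union>i. A i) \<le> (\<Sum>n. outer_content (A n)) + e" .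
qed

lemma outer_empty: "outer_content {} = 0"
  using outer_open[of "{}"] by (simp add: inner_content_def lam_empty)

text \<open>Caratheodory's criterion for open sets. A compact \<open>K\<close> inside
  \<open>H \<inter> G\<close> is chosen first; the open set \<open>H - K\<close> still contains
  \<open>H - G\<close>, and its compact subsets are disjoint from \<open>K\<close>, so
  \<open>lam\<close> adds up.\<close>

lemma outer_split_open:
  assumes "open G"
  shows "outer_content (A \<inter> G) + outer_content (A - G) \<le> outer_content A"
  unfolding outer_content_def[of A]
proof (rule INF_greatest, safe)
  fix H assume H: "open H" "A \<subseteq> H"
  have ne: "{K. compact K \<and> K \<subseteq> S} \<noteq> {}" for S :: "'a set" by (auto intro: exI[of _ "{}"])
  have 1: "lam K + outer_content (H - G) \<le> inner_content H" if K: "compact K" "K \<subseteq> H \<inter> G" for K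
  proof -
    have "open (H - K)" using H(1) compact_imp_closed[OF K(1)] by (rule open_Diff)
    then have "outer_content (H - G) \<le> inner_content (H - K)"
      using K by (intro outer_le_inner) auto
    then have "lam K + outer_content (H - G) \<le> lam K + inner_content (H - K)"
      by (rule add_left_mono)
    also have "\<dots> = (SUP L\<in>{L. compact L \<and> L \<subseteq> H - K}. lam K + lam L)"
      unfolding inner_content_def by (rule ennreal_SUP_add_right[OF ne])
    also have "\<dots> \<le> inner_content H"
    proof (rule SUP_least, safe)
      fix L assume L: "compact L" "L \<subseteq> H - K"
      have "lam K + lam L = lam (K \<union> L)" using L by (subst lam_Un) auto
      also have "\<dots> \<le> inner_content H" using K L by (intro lam_le_inner compact_Un) auto
      finally show "lam K + lam L \<le> inner_content H" .
    qed
    finally show ?thesis .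
  qed
  have "outer_content (A \<inter> G) + outer_content (A - G) \<le> inner_content (H \<inter> G) + outer_content (H - G)"
    using H assms by (intro add_mono outer_le_inner outer_mono) auto
  also have "\<dots> = (SUP K\<in>{K. compact K \<and> K \<subseteq> H \<inter> G}. lam K + outer_content (H - G))"
    unfolding inner_content_def by (rule ennreal_SUP_add_left[OF ne, symmetric])
  also have "\<dots> \<le> inner_content H" using 1 by (intro SUP_least) auto
  finally show "outer_content (A \<inter> G) + outer_content (A - G) \<le> inner_content H" .
qed

lemma outer_measure_space_outer: "outer_measure_space (Pow UNIV) outer_content"
  unfolding outer_measure_space_def positive_def increasing_def countably_subadditive_def
  using outer_empty outer_mono outer_UN_le by auto

lemma outer_subadd: "outer_content (A \<union> B) \<le> outer_content A + outer_content B"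
proof -
  interpret sigma_algebra UNIV "Pow UNIV :: 'a set set" by (rule sigma_algebra_Pow)
  have "subadditive (Pow UNIV) outer_content"
    using outer_measure_space_outer unfolding outer_measure_space_def
    by (intro countably_subadditive_subadditive) auto
  then have "outer_content (A \<union> (B - A)) \<le> outer_content A + outer_content (B - A)"
    by (rule subadditiveD) auto
  also have "\<dots> \<le> outer_content A + outer_content B" by (intro add_left_mono outer_mono) auto
  finally show ?thesis by simp
qed

definition extension :: "'a measure" where
  "extension = measure_of UNIV (sets borel) outer_content"

lemma sets_extension [simp]: "sets extension = sets borel"
  unfolding extension_def using sets.sets_measure_of_eq[of borel] by simp

lemma emeasure_extension:
  assumes "A \<in> sets borel"
  shows "emeasure extension A = outer_content A"
proof -
  interpret P: sigma_algebra UNIV "Pow UNIV :: 'a set set" by (rule sigma_algebra_Pow)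
  let ?L = "lambda_system UNIV (Pow UNIV) outer_content"
  have ms: "measure_space UNIV ?L outer_content"
    by (rule P.caratheodory_lemma[OF outer_measure_space_outer])
  have "G \<in> ?L" if "open G" for G
  proof -
    have "outer_content (A \<inter> G) + outer_content (A - G) = outer_content A" for A
    proof (rule antisym[OF outer_split_open[OF that]])
      show "outer_content A \<le> outer_content (A \<inter> G) + outer_content (A - G)"
        using outer_subadd[of "A \<inter> G" "A - G"] by (simp add: Int_Diff_Un)
    qed
    then show ?thesis unfolding P.lambda_system_eq by auto
  qed
  moreover have sa: "sigma_algebra UNIV ?L" using ms by (simp add: measure_space_def)
  ultimately have sub: "sets borel \<subseteq> ?L"
    unfolding borel_def using sigma_algebra.sigma_sets_subset[OF sa, of "{S. open S}"]
    by (auto simp: sets_measure_of)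
  have "sigma_algebra UNIV (sets borel :: 'a set set)"
    using sets.sigma_algebra_axioms[of "borel :: 'a measure"] by simp
  moreover have "positive (sets borel) outer_content" by (simp add: positive_def outer_empty)
  moreover have "countably_additive (sets borel) outer_content"
    using ms sub unfolding measure_space_def countably_additive_def by blast
  ultimately show ?thesis unfolding extension_def
    by (intro emeasure_measure_of_sigma assms)
qed

lemma emeasure_extension_open: "open G \<Longrightarrow> emeasure extension G = inner_content G"
  by (simp add: emeasure_extension outer_open)

end

section \<open>Cluster points, frontiers and ranks\<close>

lemma cluster_function:
  fixes \<nu> :: "nat \<Rightarrow> 'b \<Rightarrow> real"
  assumes "\<And>k E. \<nu> k E \<in> {0..1}"
  obtains \<phi> where "\<And>S. closed S \<Longrightarrow> eventually (\<lambda>k. \<nu> k \<in> S) sequentially \<Longrightarrow> \<phi> \<in> S"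
proof -
  \<comment> \<open>Tychonoff for arbitrarily many coordinates. The product need not be metrizable,
    so a cluster point of the filter replaces the limit of a subsequence; it satisfies every closed
    condition that holds eventually.\<close>
  have "compactin (product_topology (\<lambda>_. euclidean) UNIV) (PiE UNIV (\<lambda>_ :: 'b. {0..1 :: real}))"
    unfolding compactin_PiE by simp
  then have "compact (PiE UNIV (\<lambda>_ :: 'b. {0..1 :: real}))"
    by (simp add: euclidean_product_topology)
  moreover have "filtermap \<nu> sequentially \<noteq> bot" by (simp add: filtermap_bot_iff)
  moreover have "eventually (\<lambda>x. x \<in> PiE UNIV (\<lambda>_. {0..1})) (filtermap \<nu> sequentially)"
    using assms by (simp add: eventually_filtermap PiE_iff)
  ultimately obtain \<phi> where \<phi>: "inf (nhds \<phi>) (filtermap \<nu> sequentially) \<noteq> bot"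
    unfolding compact_filter by blast
  show ?thesis
  proof (rule that, rule ccontr)
    fix S assume S: "closed S" "eventually (\<lambda>k. \<nu> k \<in> S) sequentially" "\<phi> \<notin> S"
    have "eventually (\<lambda>x. x \<in> - S) (nhds \<phi>)"
      using S by (intro eventually_nhds_in_open) auto
    moreover have "eventually (\<lambda>x. x \<in> S) (filtermap \<nu> sequentially)"
      using S(2) by (simp add: eventually_filtermap)
    ultimately have "eventually (\<lambda>x. False) (inf (nhds \<phi>) (filtermap \<nu> sequentially))"
      unfolding eventually_inf by fastforce
    then show False using \<phi> by (simp add: trivial_limit_def)
  qed
qed

lemma notin_frontier_iff: "x \<notin> frontier S \<longleftrightarrow> (\<forall>\<^sub>F y in nhds x. y \<in> S \<longleftrightarrow> x \<in> S)"
proof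
  assume "x \<notin> frontier S"
  then consider "x \<in> interior S" | "x \<in> - closure S" by (auto simp: frontier_def)
  then show "\<forall>\<^sub>F y in nhds x. y \<in> S \<longleftrightarrow> x \<in> S"
  proof cases
    case 1
    then have "\<forall>\<^sub>F y in nhds x. y \<in> interior S" by (intro eventually_nhds_in_open) auto
    then show ?thesis by eventually_elim (use 1 interior_subset in blast)
  next
    case 2
    then have "\<forall>\<^sub>F y in nhds x. y \<in> - closure S" by (intro eventually_nhds_in_open) auto
    then show ?thesis by eventually_elim (use 2 closure_subset in blast)
  qed
next
  assume "\<forall>\<^sub>F y in nhds x. y \<in> S \<longleftrightarrow> x \<in> S"
  then obtain N where N: "open N" "x \<in> N" "\<And>y. y \<in> N \<Longrightarrow> y \<in> S \<longleftrightarrow> x \<in> S"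
    unfolding eventually_nhds by blast
  show "x \<notin> frontier S"
  proof (cases "x \<in> S")
    case True
    then have "N \<subseteq> S" using N by blast
    then show ?thesis using N(1,2) interior_maximal by (auto simp: frontier_def)
  next
    case False
    then have "N \<inter> S = {}" using N by blast
    then have "N \<inter> closure S = {}" using N(1) by (simp add: open_Int_closure_eq_empty)
    then show ?thesis using N(2) by (auto simp: frontier_def)
  qed
qed

text \<open>With \<open>rank_inj\<close> this makes rank a bijection from the points of
  \<open>P\<close> below \<open>n\<close> onto an initial segment of the naturals; blocks are paired
  by equal ranks.\<close>

lemma rank_attained:
  assumes "r < card {i. i < (n :: nat) \<and> P i}"
  obtains t where "t < n" "P t" "card {i. i < t \<and> P i} = r"
proof -
  have "\<exists>t<n. P t \<and> card {i. i < t \<and> P i} = r"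
    using assms
  proof (induction n)
    case (Suc n)
    show ?case
    proof (cases "r < card {i. i < n \<and> P i}")
      case True
      then show ?thesis using Suc.IH less_SucI by blast
    next
      case False
      have "P n"
      proof (rule ccontr)
        assume "\<not> P n"
        then have "{i. i < Suc n \<and> P i} = {i. i < n \<and> P i}" by (auto simp: less_Suc_eq)
        then show False using Suc.prems False by simp
      qed
      then have "{i. i < Suc n \<and> P i} = insert n {i. i < n \<and> P i}" by (auto simp: less_Suc_eq)
      then have "card {i. i < Suc n \<and> P i} = Suc (card {i. i < n \<and> P i})" by simp
      then have "card {i. i < n \<and> P i} = r" using False Suc.prems by simp
      then show ?thesis using \<open>P n\<close> by blast
    qed
  qed simp
  then show ?thesis using that by blast
qed

lemma rank_inj:
  assumes "P k" "P l" "card {i. i < k \<and> P i} = card {i. i < (l :: nat) \<and> P i}"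
  shows "k = l"
proof -
  have less: "card {i. i < a \<and> P i} < card {i. i < b \<and> P i}" if "a < b" "P a" for a b
    using that by (intro psubset_card_mono) auto
  show ?thesis using less[of k l] less[of l k] assms by (cases k l rule: linorder_cases) auto
qed

subsection \<open>Minimal systems and comparison of sets\<close>

lemma disjoint_subsets: "A \<subseteq> B \<Longrightarrow> C \<subseteq> D \<Longrightarrow> B \<inter> D = {} \<Longrightarrow> A \<inter> C = {}"
  by blast

lemma compact_closed_separated:
  fixes S T :: "'a::metric_space set"
  assumes "compact S" "closed T" "S \<inter> T = {}"
  shows "\<exists>\<delta>>0. \<forall>x\<in>S. \<forall>y\<in>T. \<delta> \<le> dist x y"
proof (cases "S = {} \<or> T = {}")
  case True
  then show ?thesis by (intro exI[of _ 1]) auto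
next
  case False
  have "continuous_on S (\<lambda>x. infdist x T)"
    by (intro continuous_intros)
  then obtain s where s: "s \<in> S" "\<And>x. x \<in> S \<Longrightarrow> infdist s T \<le> infdist x T"
    using continuous_attains_inf[OF assms(1)] False by blast
  have "s \<notin> T" using s assms by blast
  then have "infdist s T > 0"
    using in_closed_iff_infdist_zero[OF assms(2)] False infdist_nonneg[of s T]
    by (metis less_eq_real_def)
  moreover have "infdist s T \<le> dist x y" if "x \<in> S" "y \<in> T" for x y
    using s(2)[OF that(1)] infdist_le[OF that(2), of x] by linarith
  ultimately show ?thesis by blast
qed

locale minimal_system =
  fixes h :: "'a::metric_space \<Rightarrow> 'a"
  assumes compact_space: "compact (UNIV :: 'a set)"
    and infinite_space: "infinite (UNIV :: 'a set)"
    and bij: "bij h"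
    and cont: "continuous_on UNIV h"
    and cont_inv: "continuous_on UNIV (inv h)"
    and minimal: "minimal_hom h"
begin

abbreviation T :: "int \<Rightarrow> 'a \<Rightarrow> 'a" where "T \<equiv> hpow h"

lemma T_0 [simp]: "T 0 x = x"
  by (simp add: hpow_def)

lemma T_1 [simp]: "T 1 x = h x"
  by (simp add: hpow_def)

lemma T_succ: "T (i + 1) x = h (T i x)"
proof (cases "i \<ge> 0")
  case True
  then show ?thesis by (simp add: hpow_def nat_add_distrib)
next
  case False
  then obtain n where n: "i = - int (Suc n)"
    by (metis int_cases linorder_not_le negative_zle of_nat_0_le_iff)
  have "h (inv h y) = y" for y
    using bij by (simp add: bij_def surj_f_inv_f)
  moreover have "T (- int (Suc n)) = inv h ^^ Suc n" "T (- int n) = inv h ^^ n"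
    unfolding hpow_def by (auto simp: nat_add_distrib)
  ultimately show ?thesis unfolding n by (simp add: algebra_simps)
qed

lemma T_pred: "T (i - 1) x = inv h (T i x)"
  using T_succ[of "i - 1" x] bij by (simp add: bij_def inv_f_f)

lemma T_add: "T (i + j) x = T i (T j x)"
proof (induction i rule: int_induct[where k = 0])
  case base
  show ?case by simp
next
  case (step1 i)
  then show ?case using T_succ[of "i + j" x] T_succ[of i "T j x"] by (simp add: algebra_simps)
next
  case (step2 i)
  then show ?case using T_pred[of "i + j" x] T_pred[of i "T j x"] by (simp add: algebra_simps)
qed

lemma T_T: "T i (T j x) = T (i + j) x"
  by (simp add: T_add)

lemma T_neg_cancel [simp]: "T (- i) (T i x) = x" "T i (T (- i) x) = x"
  by (simp_all add: T_T)

lemma inj_T: "T i x = T i y \<longleftrightarrow> x = y"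
  by (metis T_neg_cancel(1))

lemma T_image_iff: "x \<in> T i ` S \<longleftrightarrow> T (- i) x \<in> S"
  by (metis T_neg_cancel image_iff)

lemma T_image_eq_vimage: "T i ` S = T (- i) -` S"
  using T_image_iff by auto

lemma continuous_T: "continuous_on UNIV (T i)"
proof (induction i rule: int_induct[where k = 0])
  case base
  have "T 0 = (\<lambda>x. x)" by (simp add: fun_eq_iff)
  then show ?case by simp
next
  case (step1 i)
  have "T (i + 1) = h \<circ> T i" by (simp add: fun_eq_iff T_succ)
  then show ?case
    using step1 continuous_on_compose[of UNIV "T i" h] continuous_on_subset[OF cont] by simp
next
  case (step2 i)
  have "T (i - 1) = inv h \<circ> T i" by (simp add: fun_eq_iff T_pred)
  then show ?case
    using step2 continuous_on_compose[of UNIV "T i" "inv h"] continuous_on_subset[OF cont_inv] by simp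
qed

lemma open_T_vimage: "open S \<Longrightarrow> open (T i -` S)"
  by (rule open_vimage[OF _ continuous_T])

lemma closed_T_vimage: "closed S \<Longrightarrow> closed (T i -` S)"
  by (rule closed_vimage[OF _ continuous_T])

lemma open_T_image: "open S \<Longrightarrow> open (T i ` S)"
  by (simp add: T_image_eq_vimage open_T_vimage)

lemma closed_T_image: "closed S \<Longrightarrow> closed (T i ` S)"
  by (simp add: T_image_eq_vimage closed_T_vimage)

lemma closed_imp_compact_space: "closed (S :: 'a set) \<Longrightarrow> compact S"
  using compact_Int_closed[OF compact_space] by simp

text \<open>The points whose orbits avoid \<open>V\<close> form a closed invariant set, empty by
  minimality; compactness then bounds the hitting time.\<close>

lemma hits_open:
  assumes "open V" "V \<noteq> {}"
  obtains R :: nat where "\<And>x. \<exists>i\<le>R. T (int i) x \<in> V"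
proof -
  define Z where "Z = - (\<Union>i. T i -` V)"
  have "closed Z"
    unfolding Z_def by (intro closed_Compl open_UN ballI open_T_vimage assms(1))
  moreover have "h ` Z = Z"
  proof -
    have "h x \<in> Z \<longleftrightarrow> x \<in> Z" for x
    proof -
      have "T i (h x) = T (i + 1) x" for i
        using T_add[of i 1 x] by simp
      then have "(\<exists>i. T i (h x) \<in> V) \<longleftrightarrow> (\<exists>i. T i x \<in> V)"
        by (metis diff_add_cancel)
      then show ?thesis unfolding Z_def by blast
    qed
    moreover have "surj h" using bij by (simp add: bij_def)
    ultimately show ?thesis by (auto simp: surj_def image_iff) metis
  qed
  moreover have "Z \<noteq> UNIV"
    using assms(2) T_0 unfolding Z_def by blast
  ultimately have "Z = {}"
    using minimal unfolding minimal_hom_def by blast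
  then have "UNIV \<subseteq> (\<Union>i\<in>UNIV. T i -` V)"
    unfolding Z_def by blast
  then obtain I where I: "finite I" "UNIV \<subseteq> (\<Union>i\<in>I. T i -` V)"
    using compactE_image[OF compact_space, of UNIV "\<lambda>i. T i -` V"] open_T_vimage[OF assms(1)] by metis
  obtain M :: int where M: "\<And>i. i \<in> I \<Longrightarrow> \<bar>i\<bar> \<le> M"
  proof
    show "\<bar>i\<bar> \<le> (\<Sum>j\<in>I. \<bar>j\<bar>)" if "i \<in> I" for i
      using that I(1) by (intro member_le_sum) auto
  qed
  \<comment> \<open>Starting from \<open>T M x\<close> turns times between \<open>- M\<close> and
    \<open>M\<close> into forward times up to \<open>2 * M\<close>.\<close>
  have "\<exists>i\<le>nat (2 * M). T (int i) x \<in> V" for x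
  proof -
    obtain i where i: "i \<in> I" "T i (T M x) \<in> V"
      using I(2) by (meson UNIV_I UN_E subsetD vimage_eq)
    have "\<bar>i\<bar> \<le> M" using M i by blast
    then have "nat (i + M) \<le> nat (2 * M)" "int (nat (i + M)) = i + M" by auto
    then show ?thesis using i(2) by (metis T_T)
  qed
  then show ?thesis by (rule that)
qed

text \<open>A periodic orbit is finite, hence closed and invariant, hence the whole infinite
  space.\<close>

lemma aperiodic:
  assumes "T d x = x"
  shows "d = 0"
proof (rule ccontr)
  assume "d \<noteq> 0"
  define p where "p = \<bar>d\<bar>"
  have p: "p > 0" using \<open>d \<noteq> 0\<close> by (simp add: p_def)
  have Tp: "T p x = x"
    using assms by (metis T_neg_cancel(1) abs_if p_def)
  have mult: "T (p * k) x = x" for k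
  proof (induction k rule: int_induct[where k = 0])
    case (step1 i)
    then show ?case using T_add[of "p * i" p x] Tp by (simp add: algebra_simps)
  next
    case (step2 i)
    have "T (- p) x = x" using Tp by (metis T_neg_cancel(1))
    then show ?case using T_add[of "p * i" "- p" x] step2 by (simp add: algebra_simps)
  qed simp
  have red: "T i x = T (i mod p) x" for i
    using T_add[of "i mod p" "p * (i div p)" x] mult by (simp add: algebra_simps)
  have "range (\<lambda>i. T i x) \<subseteq> (\<lambda>i. T i x) ` {0..<p}"
  proof (rule image_subsetI)
    fix i
    show "T i x \<in> (\<lambda>i. T i x) ` {0..<p}"
      by (rule image_eqI[of _ _ "i mod p"]) (use p red in auto)
  qed
  then have fin: "finite (range (\<lambda>i. T i x))"
    using finite_subset by blast
  have "h ` range (\<lambda>i. T i x) = range (\<lambda>i. T i x)"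
  proof -
    have "h ` range (\<lambda>i. T i x) = range (\<lambda>i. T (i + 1) x)"
      by (auto simp: T_succ)
    also have "\<dots> = range (\<lambda>i. T i x)"
    proof -
      have "T i x = T ((i - 1) + 1) x" for i by simp
      then show ?thesis by blast
    qed
    finally show ?thesis .
  qed
  then have "range (\<lambda>i. T i x) = UNIV"
    using minimal finite_imp_closed[OF fin] unfolding minimal_hom_def by blast
  then show False using fin infinite_space by simp
qed

lemma T_eq_iff: "T i x = T j x \<longleftrightarrow> i = j"
  using aperiodic[of "i - j" "T j x"] by (auto simp: T_T)

text \<open>There are no isolated points: starting from \<open>T 1 x\<close>, the orbit comes back
  to \<open>V\<close> at a positive time, by aperiodicity at a point other than
  \<open>x\<close>.\<close>

lemma split_open:
  assumes "open (V :: 'a set)" "V \<noteq> {}"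
  obtains V0 V1 where "open V0" "open V1" "V0 \<noteq> {}" "V1 \<noteq> {}" "V0 \<inter> V1 = {}"
    "V0 \<subseteq> V" "V1 \<subseteq> V"
proof -
  obtain x where x: "x \<in> V" using assms by blast
  obtain R where R: "\<And>x. \<exists>i\<le>R. T (int i) x \<in> V" using hits_open[OF assms] by blast
  obtain i where i: "T (int i) (T 1 x) \<in> V" using R by blast
  define y where "y = T (int i + 1) x"
  have y: "y \<in> V" using i by (simp only: T_T y_def)
  have "y \<noteq> x" using aperiodic[of "int i + 1" x] by (auto simp: y_def)
  then obtain A B where AB: "open A" "open B" "x \<in> A" "y \<in> B" "A \<inter> B = {}"
    by (metis hausdorff)
  show ?thesis
    by (rule that[of "A \<inter> V" "B \<inter> V"]) (use AB x y assms in auto)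
qed

text \<open>The pieces are indexed by the power of \<open>h\<close> that moves them; this loses nothing, since pieces moved by
  the same power can be merged.\<close>

definition subequiv :: "'a set \<Rightarrow> 'a set \<Rightarrow> bool" where
  "subequiv C V \<longleftrightarrow> (\<exists>K :: int \<Rightarrow> 'a set. finite {d. K d \<noteq> {}} \<and> (\<forall>d. closed (K d)) \<and>
     (\<forall>d. T d ` K d \<subseteq> V) \<and> (\<forall>d e. d \<noteq> e \<longrightarrow> T d ` K d \<inter> T e ` K e = {}) \<and> C \<subseteq> (\<Union>d. K d))"

lemma subequiv_mono: "subequiv C V \<Longrightarrow> B \<subseteq> C \<Longrightarrow> V \<subseteq> W \<Longrightarrow> subequiv B W"
  unfolding subequiv_def by (meson order_trans)

lemma subequiv_Un:
  assumes "subequiv C V" "subequiv D W" "V \<inter> W = {}"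
  shows "subequiv (C \<union> D) (V \<union> W)"
proof -
  obtain K where K: "finite {d. K d \<noteq> {}}" "\<And>d. closed (K d)" "\<And>d. T d ` K d \<subseteq> V"
    "\<And>d e. d \<noteq> e \<Longrightarrow> T d ` K d \<inter> T e ` K e = {}" "C \<subseteq> (\<Union>d. K d)"
    using assms(1) unfolding subequiv_def by blast
  obtain L where L: "finite {d. L d \<noteq> {}}" "\<And>d. closed (L d)" "\<And>d. T d ` L d \<subseteq> W"
    "\<And>d e. d \<noteq> e \<Longrightarrow> T d ` L d \<inter> T e ` L e = {}" "D \<subseteq> (\<Union>d. L d)"
    using assms(2) unfolding subequiv_def by blast
  have "{d. K d \<union> L d \<noteq> {}} = {d. K d \<noteq> {}} \<union> {d. L d \<noteq> {}}" by auto
  then have "finite {d. K d \<union> L d \<noteq> {}}" using K(1) L(1) by simp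
  moreover have "T d ` (K d \<union> L d) \<inter> T e ` (K e \<union> L e) = {}" if "d \<noteq> e" for d e
  proof -
    have "T d ` K d \<inter> T e ` L e = {}" "T d ` L d \<inter> T e ` K e = {}"
      using disjoint_subsets[OF K(3) L(3) assms(3), of d e] disjoint_subsets[OF K(3) L(3) assms(3), of e d]
      by (simp_all add: Int_commute)
    then show ?thesis
      using K(4)[OF that] L(4)[OF that] by (simp only: image_Un Int_Un_distrib Int_Un_distrib2) simp
  qed
  moreover have "T d ` (K d \<union> L d) \<subseteq> V \<union> W" for d
    using K(3)[of d] L(3)[of d] by blast
  moreover have "C \<union> D \<subseteq> (\<Union>d. K d \<union> L d)" using K(5) L(5) by blast
  ultimately show ?thesis
    unfolding subequiv_def using K(2) L(2) by (intro exI[of _ "\<lambda>d. K d \<union> L d"]) (simp add: closed_Un)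
qed

text \<open>Finitely many disjoint closed images keep positive distances \<open>\<delta> d\<close>
  from each other and from the complement of \<open>V\<close>. The open room serves twice: to remove
  a neighbourhood and keep a closed remainder, and to hold the supports of bump functions.\<close>

lemma open_enlargement:
  assumes "finite {d. K d \<noteq> {}}" "\<And>d :: int. closed (K d)" "\<And>d. T d ` K d \<subseteq> V"
    "\<And>d e. d \<noteq> e \<Longrightarrow> T d ` K d \<inter> T e ` K e = {}" "open V"
  obtains W where "\<And>d. open (W d)" "\<And>d. K d \<subseteq> W d" "\<And>d. T d ` closure (W d) \<subseteq> V"
    "\<And>d e. d \<noteq> e \<Longrightarrow> T d ` closure (W d) \<inter> T e ` closure (W e) = {}"
    "finite {d. W d \<noteq> {}}"
proof -
  define L where "L d = T d ` K d" for d
  have L: "closed (L d)" for d by (simp add: L_def closed_T_image assms(2))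
  have "\<exists>\<delta>>0. \<forall>x\<in>L d. \<forall>y\<in>- V \<union> (\<Union>e\<in>{e. K e \<noteq> {}} - {d}. L e). \<delta> \<le> dist x y" for d
  proof (rule compact_closed_separated)
    show "compact (L d)" using L closed_imp_compact_space by blast
    show "closed (- V \<union> (\<Union>e\<in>{e. K e \<noteq> {}} - {d}. L e))"
      using assms(1,5) L by (intro closed_Un closed_UN) auto
    show "L d \<inter> (- V \<union> (\<Union>e\<in>{e. K e \<noteq> {}} - {d}. L e)) = {}"
    proof -
      have "L d \<inter> L e = {}" if "e \<noteq> d" for e
        using assms(4)[of d e] that by (simp add: L_def)
      moreover have "L d \<subseteq> V" using assms(3)[of d] by (simp add: L_def)
      ultimately show ?thesis by auto
    qed
  qed
  then obtain \<delta> where \<delta>: "\<And>d. \<delta> d > 0"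
    "\<And>d x y. x \<in> L d \<Longrightarrow> y \<in> - V \<union> (\<Union>e\<in>{e. K e \<noteq> {}} - {d}. L e) \<Longrightarrow> \<delta> d \<le> dist x y"
    by metis
  have \<delta>_V: "\<delta> d \<le> dist x y" if "x \<in> L d" "y \<notin> V" for d x y
    using \<delta>(2) that by auto
  have \<delta>_L: "\<delta> d \<le> dist x y" if "x \<in> L d" "y \<in> L e" "d \<noteq> e" for d e x y
    using \<delta>(2)[OF that(1), of y] that by (auto simp: L_def)
  \<comment> \<open>Radius \<open>\<delta> d / 4\<close> keeps the closure within
    \<open>\<delta> d / 3\<close> of \<open>L d\<close>. Two such closures cannot meet, since
    \<open>\<delta> d\<close> and \<open>\<delta> e\<close> both bound the distance between
    \<open>L d\<close> and \<open>L e\<close> from below.\<close>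
  define N where "N d = (\<Union>x\<in>L d. ball x (\<delta> d / 4))" for d
  define W where "W d = T (- d) ` N d" for d
  have near: "\<exists>x\<in>L d. dist x z < \<delta> d / 3" if z: "z \<in> closure (N d)" for d z
  proof -
    have "\<delta> d / 12 > 0" using \<delta>(1)[of d] by simp
    then obtain y where y: "y \<in> N d" "dist y z < \<delta> d / 12"
      using z unfolding closure_approachable by blast
    obtain x where x: "x \<in> L d" "dist x y < \<delta> d / 4" using y(1) by (auto simp: N_def)
    have "dist x z < \<delta> d / 3" using dist_triangle[of x z y] x(2) y(2) by linarith
    then show ?thesis using x by blast
  qed
  have TW: "T d ` closure (W d) \<subseteq> closure (N d)" for d
  proof -
    have "closure (W d) \<subseteq> T (- d) ` closure (N d)"
      by (rule closure_minimal) (auto simp: W_def closed_T_image closure_subset intro: subsetD[OF closure_subset])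
    then show ?thesis by (auto simp: image_subset_iff)
  qed
  show ?thesis
  proof (rule that[of W])
    show "open (W d)" for d unfolding W_def N_def by (intro open_T_image open_UN) auto
    show "K d \<subseteq> W d" for d
    proof
      fix x assume "x \<in> K d"
      then have "T d x \<in> N d" using \<delta>(1)[of d] unfolding N_def L_def by (force intro!: bexI[of _ x])
      then show "x \<in> W d" by (simp add: W_def T_image_iff)
    qed
    show "T d ` closure (W d) \<subseteq> V" for d
    proof -
      have "closure (N d) \<subseteq> V"
        using near[of _ d] \<delta>_V[of _ d] \<delta>(1)[of d] by force
      then show ?thesis using TW by blast
    qed
    show "T d ` closure (W d) \<inter> T e ` closure (W e) = {}" if "d \<noteq> e" for d e
    proof -
      have False if z: "z \<in> closure (N d)" "z \<in> closure (N e)" for z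
      proof -
        obtain x y where xy: "x \<in> L d" "dist x z < \<delta> d / 3" "y \<in> L e" "dist y z < \<delta> e / 3"
          using near z by metis
        have "\<delta> d \<le> dist x y" "\<delta> e \<le> dist x y"
          using \<delta>_L[OF xy(1,3) \<open>d \<noteq> e\<close>] \<delta>_L[OF xy(3,1)] \<open>d \<noteq> e\<close> by (auto simp: dist_commute)
        moreover have "dist x y < \<delta> d / 3 + \<delta> e / 3"
          using dist_triangle2[of x y z] xy by linarith
        ultimately show False using \<delta>(1)[of d] \<delta>(1)[of e] by linarith
      qed
      then show ?thesis using TW by blast
    qed
    have "{d. W d \<noteq> {}} \<subseteq> {d. K d \<noteq> {}}" by (auto simp: W_def N_def L_def)
    then show "finite {d. W d \<noteq> {}}" using assms(1) finite_subset by blast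
  qed
qed

lemma subequiv_openE:
  assumes "subequiv C V" "open V"
  obtains W where "\<And>d. open (W d)" "C \<subseteq> (\<Union>d. W d)" "\<And>d. T d ` closure (W d) \<subseteq> V"
    "\<And>d e. d \<noteq> e \<Longrightarrow> T d ` closure (W d) \<inter> T e ` closure (W e) = {}"
    "finite {d. W d \<noteq> {}}"
proof -
  obtain K where K: "finite {d. K d \<noteq> {}}" "\<And>d. closed (K d)" "\<And>d. T d ` K d \<subseteq> V"
    "\<And>d e. d \<noteq> e \<Longrightarrow> T d ` K d \<inter> T e ` K e = {}" "C \<subseteq> (\<Union>d. K d)"
    using assms(1) unfolding subequiv_def by blast
  obtain W where W: "\<And>d. open (W d)" "\<And>d. K d \<subseteq> W d" "\<And>d. T d ` closure (W d) \<subseteq> V"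
    "\<And>d e. d \<noteq> e \<Longrightarrow> T d ` closure (W d) \<inter> T e ` closure (W e) = {}"
    "finite {d. W d \<noteq> {}}"
    using open_enlargement[OF K(1-4) assms(2)] by blast
  have "C \<subseteq> (\<Union>d. W d)"
    by (rule order_trans[OF K(5)]) (intro UN_mono order_refl W(2))
  then show ?thesis by (rule that[OF W(1) _ W(3-5)])
qed

subsection \<open>Topologically small sets\<close>

text \<open>The pointwise form of \<open>top_small\<close>: images under \<open>m + 1\<close>
  distinct powers have no common point exactly when no orbit visits \<open>F\<close> more than
  \<open>m\<close> times. The bound is explicit because the induction runs on it.\<close>

definition small :: "nat \<Rightarrow> 'a set \<Rightarrow> bool" where
  "small m F \<longleftrightarrow> (\<forall>x. finite {d. T d x \<in> F} \<and> card {d. T d x \<in> F} \<le> m)"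

lemma top_small_imp_small:
  assumes "top_small h F"
  obtains m where "small m F"
proof -
  obtain m where m: "\<And>d :: nat \<Rightarrow> int. inj_on d {0..m} \<Longrightarrow> (\<Inter>j\<in>{0..m}. T (d j) ` F) = {}"
    using assms unfolding top_small_def by blast
  have "finite {d. T d x \<in> F} \<and> card {d. T d x \<in> F} \<le> m" for x
  proof (rule ccontr)
    assume *: "\<not> ?thesis"
    have "\<exists>D. D \<subseteq> {d. T d x \<in> F} \<and> finite D \<and> card D = Suc m"
    proof (cases "finite {d. T d x \<in> F}")
      case True
      then have "Suc m \<le> card {d. T d x \<in> F}" using * by simp
      then show ?thesis by (meson obtain_subset_with_card_n)
    next
      case False
      then show ?thesis using infinite_arbitrarily_large by blast
    qed
    then obtain D where D: "D \<subseteq> {d. T d x \<in> F}" "finite D" "card D = Suc m" by blast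
    obtain f where f: "bij_betw f {0..<Suc m} D"
      using ex_bij_betw_nat_finite[OF D(2)] D(3) by metis
    have "inj_on (\<lambda>j. - f j) {0..m}"
      using f by (auto simp: bij_betw_def inj_on_def)
    then have "(\<Inter>j\<in>{0..m}. T (- f j) ` F) = {}" by (rule m)
    moreover have "x \<in> T (- f j) ` F" if "j \<in> {0..m}" for j
    proof -
      have "f j \<in> D" using f that by (auto simp: bij_betw_def)
      then show ?thesis using D(1) by (auto simp: T_image_iff)
    qed
    ultimately show False by blast
  qed
  then show ?thesis using that unfolding small_def by blast
qed

lemma small_Un:
  assumes "small m F" "small n G"
  shows "small (m + n) (F \<union> G)"
  unfolding small_def
proof
  fix x
  have eq: "{d. T d x \<in> F \<union> G} = {d. T d x \<in> F} \<union> {d. T d x \<in> G}" by auto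
  have "card {d. T d x \<in> F} \<le> m" "card {d. T d x \<in> G} \<le> n"
    using assms unfolding small_def by auto
  then have "card {d. T d x \<in> F \<union> G} \<le> m + n"
    unfolding eq using card_Un_le[of "{d. T d x \<in> F}" "{d. T d x \<in> G}"] by linarith
  then show "finite {d. T d x \<in> F \<union> G} \<and> card {d. T d x \<in> F \<union> G} \<le> m + n"
    unfolding eq using assms by (auto simp: small_def)
qed

lemma small_T_vimage:
  assumes "small m F"
  shows "small m (T i -` F)"
  unfolding small_def
proof
  fix x
  have "{d. T d x \<in> T i -` F} = (\<lambda>d. d - i) ` {d. T d x \<in> F}"
  proof (rule set_eqI)
    fix d
    have "d \<in> (\<lambda>d. d - i) ` {d. T d x \<in> F} \<longleftrightarrow> T (d + i) x \<in> F"
      by (auto simp: image_iff)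
    then show "d \<in> {d. T d x \<in> T i -` F} \<longleftrightarrow> d \<in> (\<lambda>d. d - i) ` {d. T d x \<in> F}"
      by (simp add: T_T add.commute)
  qed
  moreover have "inj_on (\<lambda>d. d - i) {d. T d x \<in> F}" by (auto simp: inj_on_def)
  ultimately show "finite {d. T d x \<in> T i -` F} \<and> card {d. T d x \<in> T i -` F} \<le> m"
    using assms by (auto simp: small_def card_image)
qed

lemma small_UN:
  assumes "finite I" "\<And>i. i \<in> I \<Longrightarrow> \<exists>m. small m (F i)"
  shows "\<exists>m. small m (\<Union>i\<in>I. F i)"
  using assms
proof (induction I rule: finite_induct)
  case empty
  have "small 0 {}" by (simp add: small_def)
  then show ?case by auto
next
  case (insert i I)
  obtain m n where "small m (F i)" "small n (\<Union>i\<in>I. F i)" using insert by blast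
  then have "small (m + n) (\<Union>i\<in>insert i I. F i)" using small_Un by simp
  then show ?case by blast
qed

text \<open>The visit times to the overlap are those \<open>d\<close> in a finite set
  \<open>S\<close> with \<open>d + e\<close> in \<open>S\<close>. A nonempty finite set of integers
  is not stable under a nonzero shift, so at least one visit is lost.\<close>

lemma small_overlap:
  assumes "small (Suc m) F" "e \<noteq> 0"
  shows "small m (F \<inter> T e -` F)"
  unfolding small_def
proof
  fix x
  define S where "S = {d. T d x \<in> F}"
  define S' where "S' = {d. T d x \<in> F \<inter> T e -` F}"
  have S: "finite S" "card S \<le> Suc m" using assms(1) by (auto simp: small_def S_def)
  have S': "S' = {d \<in> S. d + e \<in> S}"
    by (auto simp: S'_def S_def T_T add.commute)
  have "card S' \<le> m"
  proof (cases "S = {}")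
    case True
    then show ?thesis by (simp add: S')
  next
    case False
    have "S' \<noteq> S"
    proof
      assume "S' = S"
      then have closed: "d + e \<in> S" if "d \<in> S" for d using that S' by blast
      show False
      proof (cases "e > 0")
        case True
        then show False using closed[OF Max_in[OF S(1) False]] Max_ge[OF S(1)] by fastforce
      next
        case False
        then show False using closed[OF Min_in[OF S(1) \<open>S \<noteq> {}\<close>]] Min_le[OF S(1)] assms(2) by fastforce
      qed
    qed
    then have "S' \<subset> S" using S' by blast
    then have "card S' < card S" using S(1) by (simp add: psubset_card_mono)
    then show ?thesis using S(2) by simp
  qed
  moreover have "finite S'" using S(1) S' by simp
  ultimately show "finite {d. T d x \<in> F \<inter> T e -` F} \<and> card {d. T d x \<in> F \<inter> T e -` F} \<le> m"
    by (simp add: S'_def)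
qed

section \<open>Sets that can be moved into every nonempty open set\<close>

definition thin :: "'a set \<Rightarrow> bool" where
  "thin F \<longleftrightarrow> (\<forall>V. open V \<longrightarrow> V \<noteq> {} \<longrightarrow> subequiv F V)"

lemma thin_empty: "thin {}"
  unfolding thin_def subequiv_def by (auto intro!: exI[of _ "\<lambda>_. {}"])

lemma thin_Un:
  assumes "thin F" "thin G"
  shows "thin (F \<union> G)"
  unfolding thin_def
proof (intro allI impI)
  fix V :: "'a set" assume "open V" "V \<noteq> {}"
  then obtain V0 V1 where V: "open V0" "open V1" "V0 \<noteq> {}" "V1 \<noteq> {}" "V0 \<inter> V1 = {}"
    "V0 \<subseteq> V" "V1 \<subseteq> V"
    using split_open by metis
  have "subequiv (F \<union> G) (V0 \<union> V1)"
    using assms V unfolding thin_def by (intro subequiv_Un) auto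
  then show "subequiv (F \<union> G) V"
    by (rule subequiv_mono) (use V in auto)
qed

lemma thin_UN:
  assumes "finite I" "\<And>i. i \<in> I \<Longrightarrow> thin (F i)"
  shows "thin (\<Union>i\<in>I. F i)"
  using assms by (induction I rule: finite_induct) (auto intro: thin_empty thin_Un)

text \<open>Move \<open>F\<close> into half of \<open>V\<close> piecewise.  Images of pieces under different powers meet only over
  points of some \<open>F \<inter> h\<^sup>-\<^sup>e F\<close>, a set with a smaller constant, which is moved into the other half.\<close>

lemma small_imp_thin:
  assumes "closed F" "small m F"
  shows "thin F"
  using assms
proof (induction m arbitrary: F)
  case 0
  have "F = {}"
  proof (rule ccontr)
    assume "F \<noteq> {}"
    then obtain x where "x \<in> F" by blast
    then have "0 \<in> {d. T d x \<in> F}" by simp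
    moreover have "finite {d. T d x \<in> F}" "card {d. T d x \<in> F} = 0"
      using 0 unfolding small_def by auto
    ultimately show False by (metis card_gt_0_iff empty_iff less_irrefl)
  qed
  then show ?case using thin_empty by simp
next
  case (Suc m)
  show ?case unfolding thin_def
  proof (intro allI impI)
    fix V :: "'a set" assume "open V" "V \<noteq> {}"
    then obtain V0 V1 where V: "open V0" "open V1" "V0 \<noteq> {}" "V1 \<noteq> {}" "V0 \<inter> V1 = {}"
      "V0 \<subseteq> V" "V1 \<subseteq> V"
      using split_open by metis
    obtain R where R: "\<And>x. \<exists>i\<le>R. T (int i) x \<in> V0" using hits_open[OF V(1,3)] by blast
    \<comment> \<open>If two powers in \<open>{0..int R}\<close> bring points of \<open>F\<close> to
      the same place, equal powers force equal points, and different powers make the points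
      translates of each other by a power in \<open>E\<close>.\<close>
    define E :: "int set" where "E = {- int R..int R} - {0}"
    define G where "G = (\<Union>e\<in>E. F \<inter> T e -` F)"
    have "thin G" unfolding G_def
    proof (rule thin_UN)
      show "finite E" by (simp add: E_def)
      show "thin (F \<inter> T e -` F)" if "e \<in> E" for e
        using that Suc.prems
        by (intro Suc.IH closed_Int closed_T_vimage small_overlap) (auto simp: E_def)
    qed
    then have "subequiv G V1" using V unfolding thin_def by blast
    then obtain W where W: "\<And>d. open (W d)" "G \<subseteq> (\<Union>d. W d)" "\<And>d. T d ` closure (W d) \<subseteq> V1"
      "\<And>d e. d \<noteq> e \<Longrightarrow> T d ` closure (W d) \<inter> T e ` closure (W e) = {}"
      "finite {d. W d \<noteq> {}}"
      using subequiv_openE[OF _ V(2)] by metis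
    \<comment> \<open>\<open>G\<close> is removed with an open neighbourhood, which goes to
      \<open>V1\<close>; the remainder is closed and can be moved to \<open>V0\<close> without
      collisions.\<close>
    define F' where "F' = F - (\<Union>d. W d)"
    have "closed F'" unfolding F'_def using Suc.prems(1) W(1) by (intro closed_Diff open_UN) auto
    have "\<exists>d e. 0 < e \<and> d \<in> {0..int R} \<and> T d ` cball x e \<subseteq> V0" for x
    proof -
      obtain i where i: "i \<le> R" "T (int i) x \<in> V0" using R by blast
      have "open (T (int i) -` V0)" "x \<in> T (int i) -` V0" using V(1) i by (auto intro: open_T_vimage)
      then obtain e where "e > 0" "cball x e \<subseteq> T (int i) -` V0"
        using open_contains_cball by blast
      then show ?thesis using i by (intro exI[of _ "int i"] exI[of _ e]) auto
    qed
    then obtain d r where dr: "\<And>x. 0 < r x" "\<And>x. d x \<in> {0..int R}" "\<And>x. T (d x) ` cball x (r x) \<subseteq> V0"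
      by metis
    have "F' \<subseteq> (\<Union>x\<in>F'. ball x (r x))" using dr(1) by force
    then obtain P where P: "P \<subseteq> F'" "finite P" "F' \<subseteq> (\<Union>x\<in>P. ball x (r x))"
      using compactE_image[OF closed_imp_compact_space[OF \<open>closed F'\<close>], of F' "\<lambda>x. ball x (r x)"] by blast
    define K where "K j = F' \<inter> (\<Union>x\<in>{x \<in> P. d x = j}. cball x (r x))" for j
    have "subequiv F' V0" unfolding subequiv_def
    proof (intro exI[of _ K] conjI allI impI)
      have "{j. K j \<noteq> {}} \<subseteq> d ` P" by (auto simp: K_def)
      then show "finite {j. K j \<noteq> {}}" using P(2) finite_subset by blast
      show "closed (K j)" for j
        unfolding K_def using \<open>closed F'\<close> P(2) by (intro closed_Int closed_UN) auto
      show "T j ` K j \<subseteq> V0" for j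
        using dr(3) unfolding K_def by blast
      show "T i ` K i \<inter> T j ` K j = {}" if "i \<noteq> j" for i j
      proof (rule ccontr)
        assume "T i ` K i \<inter> T j ` K j \<noteq> {}"
        then obtain x y where xy: "x \<in> K i" "y \<in> K j" "T i x = T j y" by blast
        have ij: "i \<in> {0..int R}" "j \<in> {0..int R}"
          using xy(1,2) dr(2) unfolding K_def by blast+
        have "y = T (i - j) x"
          using xy(3) by (metis T_T T_neg_cancel(1) diff_conv_add_uminus add.commute)
        then have "x \<in> F \<inter> T (i - j) -` F" using xy by (auto simp: K_def F'_def)
        moreover have "i - j \<in> E" using ij that by (auto simp: E_def)
        ultimately have "x \<in> G" by (auto simp: G_def)
        then have "x \<in> (\<Union>d. W d)" using W(2) by blast
        then show False using xy(1) by (auto simp: K_def F'_def)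
      qed
      show "F' \<subseteq> (\<Union>j. K j)" using P(3) by (force simp: K_def)
    qed
    moreover have "subequiv (\<Union>d. W d) V1" unfolding subequiv_def
    proof (intro exI[of _ "\<lambda>d. closure (W d)"] conjI allI impI)
      show "finite {d. closure (W d) \<noteq> {}}" using W(5) by simp
      show "(\<Union>d. W d) \<subseteq> (\<Union>d. closure (W d))" by (intro UN_mono closure_subset order_refl)
    qed (use W in auto)
    ultimately have "subequiv (F' \<union> (\<Union>d. W d)) (V0 \<union> V1)" using V(5) by (intro subequiv_Un)
    then show "subequiv F V" by (rule subequiv_mono) (use V in \<open>auto simp: F'_def\<close>)
  qed
qed

subsection \<open>Invariant measures and orbit windows\<close>

abbreviation visits :: "'a set \<Rightarrow> nat \<Rightarrow> 'a \<Rightarrow> nat" where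
  "visits A n x \<equiv> card {i. i < n \<and> T (int i) x \<in> A}"

lemma visits_mono: "A \<subseteq> B \<Longrightarrow> visits A n x \<le> visits B n x"
  by (intro card_mono) auto

lemma visits_eq_sum: "real (visits A n x) = (\<Sum>i<n. indicator A (T (int i) x))"
proof -
  have "(\<Sum>i<n. indicator A (T (int i) x)) = (\<Sum>i\<in>{i. i < n \<and> T (int i) x \<in> A}. 1 :: real)"
    by (rule sum.mono_neutral_cong_right) (auto simp: indicator_def)
  then show ?thesis by simp
qed

text \<open>Visits to the preimage are visits to \<open>A\<close> one step later, so only the two
  end times of the window matter. Hence empirical averages over long windows are nearly
  invariant.\<close>

lemma visits_vimage: "\<bar>real (visits (h -` A) n x) - real (visits A n x)\<bar> \<le> 1"
proof -
  define f where "f i = (indicator A (T (int i) x) :: real)" for i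
  have "T (int (Suc i)) x = h (T (int i) x)" for i
    using T_succ[of "int i" x] by (simp add: add.commute)
  then have "real (visits (h -` A) n x) = (\<Sum>i<n. f (Suc i))"
    unfolding visits_eq_sum f_def by (simp add: indicator_def)
  moreover have "f 0 + (\<Sum>i<n. f (Suc i)) = (\<Sum>i<n. f i) + f n"
    using sum.lessThan_Suc_shift[of f n] by simp
  moreover have "real (visits A n x) = (\<Sum>i<n. f i)" unfolding visits_eq_sum f_def ..
  moreover have "0 \<le> f i" "f i \<le> 1" for i by (auto simp: f_def indicator_def)
  ultimately show ?thesis using \<open>\<And>i. 0 \<le> f i\<close>[of 0] \<open>\<And>i. f i \<le> 1\<close>[of 0] 
      \<open>\<And>i. 0 \<le> f i\<close>[of n] \<open>\<And>i. f i \<le> 1\<close>[of n] by linarith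
qed

text \<open>A homeomorphism permutes the compact sets and the open sets, so invariance passes from
  \<open>lam\<close> to the inner and then to the outer content.\<close>

lemma extension_invariant:
  assumes "finitely_additive lam" and inv: "\<And>E. lam (h -` E) = lam E"
  shows "finitely_additive.extension lam \<in> inv_measures h"
proof -
  interpret finitely_additive lam by fact
  have surj: "surj h" and inj: "inj h" using bij by (auto simp: bij_def)
  have comp: "compact K" if "closed K" for K :: "'a set" using closed_imp_compact_space that .
  have cl_vimage: "closed (h -` K)" if "closed K" for K :: "'a set"
    using closed_T_vimage[OF that, of 1] by (simp add: vimage_def)
  have cl_image: "closed (h ` K)" if "closed K" for K :: "'a set"
    using closed_T_image[OF that, of 1] by (simp add: image_def)
  have op_vimage: "open (h -` G)" if "open G" for G :: "'a set"
    using open_T_vimage[OF that, of 1] by (simp add: vimage_def)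
  have op_image: "open (h ` G)" if "open G" for G :: "'a set"
    using open_T_image[OF that, of 1] by (simp add: image_def)
  have inner: "inner_content (h -` G) = inner_content G" for G
  proof (rule antisym)
    show "inner_content (h -` G) \<le> inner_content G"
      unfolding inner_content_def[of "h -` G"]
    proof (rule SUP_least, safe)
      fix K assume K: "compact K" "K \<subseteq> h -` G"
      have "lam K = lam (h ` K)" using inv[of "h ` K"] by (simp add: inj_vimage_image_eq[OF inj])
      also have "\<dots> \<le> inner_content G"
        using K cl_image comp compact_imp_closed by (intro lam_le_inner) auto
      finally show "lam K \<le> inner_content G" .
    qed
    show "inner_content G \<le> inner_content (h -` G)"
      unfolding inner_content_def[of G]
    proof (rule SUP_least, safe)
      fix K assume K: "compact K" "K \<subseteq> G"
      have "lam K = lam (h -` K)" by (simp add: inv)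
      also have "\<dots> \<le> inner_content (h -` G)"
        using K cl_vimage comp compact_imp_closed by (intro lam_le_inner) auto
      finally show "lam K \<le> inner_content (h -` G)" .
    qed
  qed
  have outer: "outer_content (h -` A) = outer_content A" for A
  proof (rule antisym)
    show "outer_content (h -` A) \<le> outer_content A"
      unfolding outer_content_def[of A]
    proof (rule INF_greatest, safe)
      fix G assume "open G" "A \<subseteq> G"
      then have "outer_content (h -` A) \<le> inner_content (h -` G)"
        using op_vimage by (intro outer_le_inner) auto
      then show "outer_content (h -` A) \<le> inner_content G" by (simp add: inner)
    qed
    show "outer_content A \<le> outer_content (h -` A)"
      unfolding outer_content_def[of "h -` A"]
    proof (rule INF_greatest, safe)
      fix G assume G: "open G" "h -` A \<subseteq> G"
      have "A \<subseteq> h ` G" using G(2) surj by (metis image_mono surj_image_vimage_eq)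
      then have "outer_content A \<le> inner_content (h ` G)"
        using op_image G by (intro outer_le_inner) auto
      also have "\<dots> = inner_content G" using inner[of "h ` G"] by (simp add: inj_vimage_image_eq[OF inj])
      finally show "outer_content A \<le> inner_content G" .
    qed
  qed
  have space: "space extension = UNIV"
    using sets_eq_imp_space_eq[OF sets_extension] by simp
  have "emeasure extension UNIV = 1"
  proof -
    have "1 \<le> inner_content UNIV"
      using lam_le_inner[of UNIV UNIV] compact_space lam_UNIV by simp
    then show ?thesis using inner_le_1[of UNIV] by (simp add: emeasure_extension_open)
  qed
  then have "prob_space extension" by (intro prob_spaceI) (simp add: space)
  moreover have "emeasure extension (h -` A) = emeasure extension A" if "A \<in> sets borel" for A
  proof -
    have "h -` A \<in> sets borel"
      using measurable_sets[OF borel_measurable_continuous_onI[OF cont] that] by simp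
    then show ?thesis using that by (simp add: emeasure_extension outer)
  qed
  ultimately show ?thesis unfolding inv_measures_def by simp
qed

text \<open>If the windows never separate \<open>C\<close> from \<open>U\<close>, a cluster point of the empirical measures of bad
  windows, taken in the compact space of all set functions, is finitely additive and invariant; its
  regularisation is an invariant measure with \<open>\<mu>(U) \<le> \<mu>(C)\<close>.\<close>

lemma window_comparison:
  assumes C: "closed C" and U: "open U"
    and less: "\<And>\<mu>. \<mu> \<in> inv_measures h \<Longrightarrow> emeasure \<mu> C < emeasure \<mu> U"
  shows "\<exists>W K N. open W \<and> C \<subseteq> W \<and> closed K \<and> K \<subseteq> U \<and> (\<forall>n\<ge>N. \<forall>x. visits W n x < visits K n x)"
proof (rule ccontr)
  assume neg: "\<not> ?thesis"
  \<comment> \<open>The neighbourhoods shrink to \<open>C\<close> and the closed sets exhaust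
    \<open>U\<close>, so a window that is bad for \<open>k\<close> is also bad for every smaller
    index.\<close>
  define W where "W k = (\<Union>c\<in>C. ball c (1 / real (Suc k)))" for k
  define K where "K k = {x. \<forall>y\<in>- U. 1 / real (Suc k) \<le> dist x y}" for k
  have small: "1 / real (Suc l) \<le> 1 / real (Suc k)" if "k \<le> l" for k l
    using that by (intro divide_left_mono) auto
  have W_anti: "W l \<subseteq> W k" if "k \<le> l" for k l
    unfolding W_def using small[OF that] by (intro UN_mono subset_ball order_refl)
  have K_mono: "K k \<subseteq> K l" if "k \<le> l" for k l
    unfolding K_def using small[OF that] by force
  \<comment> \<open>Windows of length at least \<open>Suc k\<close> make the shift error in
    \<open>\<phi>_inv\<close> tend to zero.\<close>
  define bad where "bad k n x \<longleftrightarrow> n \<ge> Suc k \<and> visits (K k) n x \<le> visits (W k) n x" for k n x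
  have "\<exists>n x. bad k n x" for k
  proof -
    have "open (W k)" "C \<subseteq> W k" unfolding W_def by auto
    moreover have "closed (K k)"
    proof -
      have "K k = (\<Inter>y\<in>- U. {x. 1 / real (Suc k) \<le> dist x y})" by (auto simp: K_def)
      then show ?thesis by (auto intro!: closed_INT closed_Collect_le continuous_intros)
    qed
    moreover have "K k \<subseteq> U" unfolding K_def
    proof
      fix x assume "x \<in> {x. \<forall>y\<in>- U. 1 / real (Suc k) \<le> dist x y}"
      then have "x \<notin> U \<Longrightarrow> 1 / real (Suc k) \<le> dist x x" by blast
      moreover have "1 / real (Suc k) > 0" by simp
      ultimately show "x \<in> U" by fastforce
    qed
    ultimately have "\<not> (\<forall>n\<ge>Suc k. \<forall>x. visits (W k) n x < visits (K k) n x)" using neg by blast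
    then show ?thesis unfolding bad_def not_all not_imp not_less by blast
  qed
  then obtain n x where "\<And>k. bad k (n k) (x k)" by metis
  then have nx: "\<And>k. n k \<ge> Suc k" "\<And>k. visits (K k) (n k) (x k) \<le> visits (W k) (n k) (x k)"
    unfolding bad_def by blast+
  define \<nu> where "\<nu> k E = real (visits E (n k) (x k)) / real (n k)" for k E
  have n_pos: "real (n k) > 0" for k using nx(1)[of k] by simp
  have "visits E m y \<le> m" for E m y
    using card_mono[of "{..<m}" "{i. i < m \<and> T (int i) y \<in> E}"] by auto
  then have "\<nu> k E \<in> {0..1}" for k E
    using n_pos[of k] by (simp add: \<nu>_def divide_le_eq)
  then obtain \<phi> where \<phi>: "\<And>S. closed S \<Longrightarrow> eventually (\<lambda>k. \<nu> k \<in> S) sequentially \<Longrightarrow> \<phi> \<in> S"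
    using cluster_function[of \<nu>] by blast
  \<comment> \<open>This and the next properties each involve finitely many coordinates and so
    define closed sets of functions.\<close>
  have \<phi>_le: "\<phi> E \<le> \<phi> F" if "\<forall>\<^sub>F k in sequentially. \<nu> k E \<le> \<nu> k F" for E F
    using \<phi>[of "{f. f E \<le> f F}"] that by (simp add: closed_Collect_le)
  have \<phi>_nonneg: "0 \<le> \<phi> E" for E
    using \<phi>[of "{f. 0 \<le> f E}"] by (simp add: closed_Collect_le \<nu>_def)
  have \<phi>_UNIV: "\<phi> UNIV = 1"
  proof -
    have "\<nu> k UNIV = 1" for k using n_pos[of k] by (simp add: \<nu>_def)
    then show ?thesis using \<phi>[of "{f. f UNIV = 1}"] by (simp add: closed_Collect_eq)
  qed
  have \<phi>_Un: "\<phi> (A \<union> B) = \<phi> A + \<phi> B" if "A \<inter> B = {}" for A B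
  proof -
    have "\<nu> k (A \<union> B) = \<nu> k A + \<nu> k B" for k
      unfolding \<nu>_def visits_eq_sum indicator_add[OF that, symmetric]
      by (simp add: sum.distrib add_divide_distrib)
    moreover have "closed {f. f (A \<union> B) = f A + (f B :: real)}"
      by (intro closed_Collect_eq continuous_intros continuous_on_product_coordinates)
    ultimately show ?thesis using \<phi>[of "{f. f (A \<union> B) = f A + f B}"] by simp
  qed
  have \<phi>_inv: "\<phi> (h -` E) = \<phi> E" for E
  proof -
    have "\<bar>\<phi> (h -` E) - \<phi> E\<bar> \<le> 1 / real (Suc m)" for m
    proof -
      have "\<bar>\<nu> k (h -` E) - \<nu> k E\<bar> \<le> 1 / real (Suc m)" if "k \<ge> m" for k
      proof -
        have "\<bar>\<nu> k (h -` E) - \<nu> k E\<bar> = \<bar>real (visits (h -` E) (n k) (x k)) - real (visits E (n k) (x k))\<bar> / real (n k)"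
          unfolding \<nu>_def diff_divide_distrib[symmetric] by (simp add: abs_divide)
        also have "\<dots> \<le> 1 / real (n k)"
          using n_pos[of k] by (intro divide_right_mono visits_vimage) auto
        also have "\<dots> \<le> 1 / real (Suc m)"
          using nx(1)[of k] that by (intro divide_left_mono) (auto simp: n_pos)
        finally show ?thesis .
      qed
      moreover have "closed {f. \<bar>f (h -` E) - (f E :: real)\<bar> \<le> 1 / real (Suc m)}"
        by (intro closed_Collect_le continuous_intros continuous_on_product_coordinates)
      ultimately show ?thesis
        using \<phi>[of "{f. \<bar>f (h -` E) - f E\<bar> \<le> 1 / real (Suc m)}"]
        by (simp add: eventually_sequentially) blast
    qed
    then have "\<bar>\<phi> (h -` E) - \<phi> E\<bar> \<le> 0 + e" if "e > 0" for e
      using nat_approx_posE[OF that] by (metis add_0 less_eq_real_def order_trans)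
    then have "\<bar>\<phi> (h -` E) - \<phi> E\<bar> \<le> 0" by (rule field_le_epsilon)
    then show ?thesis by simp
  qed
  have KW: "\<phi> (K m) \<le> \<phi> (W m)" for m
  proof (rule \<phi>_le)
    have "\<nu> k (K m) \<le> \<nu> k (W m)" if "k \<ge> m" for k
    proof -
      have "visits (K m) (n k) (x k) \<le> visits (K k) (n k) (x k)"
        by (rule visits_mono[OF K_mono[OF that]])
      also have "\<dots> \<le> visits (W k) (n k) (x k)" by (rule nx(2))
      also have "\<dots> \<le> visits (W m) (n k) (x k)"
        by (rule visits_mono[OF W_anti[OF that]])
      finally show ?thesis using n_pos[of k] by (simp add: \<nu>_def divide_right_mono)
    qed
    then show "\<forall>\<^sub>F k in sequentially. \<nu> k (K m) \<le> \<nu> k (W m)"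
      unfolding eventually_sequentially by blast
  qed
  have fa: "finitely_additive (\<lambda>E. ennreal (\<phi> E))"
    by unfold_locales (use \<phi>_UNIV \<phi>_Un \<phi>_nonneg in auto)
  interpret finitely_additive "\<lambda>E. ennreal (\<phi> E)" by (rule fa)
  have "inner_content U \<le> outer_content C"
    unfolding outer_content_def
  proof (rule INF_greatest, safe)
    fix G assume G: "open G" "C \<subseteq> G"
    show "inner_content U \<le> inner_content G"
      unfolding inner_content_def[of U]
    proof (rule SUP_least, safe)
      fix L assume L: "compact L" "L \<subseteq> U"
      obtain \<delta> where \<delta>: "\<delta> > 0" "\<And>c y. c \<in> C \<Longrightarrow> y \<notin> G \<Longrightarrow> \<delta> \<le> dist c y"
        using compact_closed_separated[of C "- G"] closed_imp_compact_space[OF C] G by blast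
      obtain \<epsilon> where \<epsilon>: "\<epsilon> > 0" "\<And>z y. z \<in> L \<Longrightarrow> y \<notin> U \<Longrightarrow> \<epsilon> \<le> dist z y"
        using compact_closed_separated[of L "- U"] L U by blast
      obtain m where m: "1 / real (Suc m) < min (\<delta> / 2) \<epsilon>"
        using nat_approx_posE[of "min (\<delta> / 2) \<epsilon>"] \<delta>(1) \<epsilon>(1) by auto
      have "L \<subseteq> K m" unfolding K_def using \<epsilon>(2) m by force
      \<comment> \<open>\<open>inner_content G\<close> sees only compact sets, so \<open>W m\<close>
        is replaced by its closure; half of the gap \<open>\<delta>\<close> was kept in the choice
        of \<open>m\<close> to make this closure fit.\<close>
      have "closure (W m) \<subseteq> G"
      proof (rule ccontr)
        assume "\<not> closure (W m) \<subseteq> G"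
        then obtain y where y: "y \<in> closure (W m)" "y \<notin> G" by blast
        then obtain w where w: "w \<in> W m" "dist w y < \<delta> / 2"
          using \<delta>(1) unfolding closure_approachable by (meson half_gt_zero)
        then obtain c where c: "c \<in> C" "dist c w < 1 / real (Suc m)" by (auto simp: W_def)
        have "dist c y < \<delta>" using dist_triangle[of c y w] w c m by linarith
        then show False using \<delta>(2)[OF c(1) y(2)] by linarith
      qed
      have "ennreal (\<phi> L) \<le> ennreal (\<phi> (K m))" by (rule lam_mono[OF \<open>L \<subseteq> K m\<close>])
      also have "\<dots> \<le> ennreal (\<phi> (W m))" by (intro ennreal_leI KW)
      also have "\<dots> \<le> ennreal (\<phi> (closure (W m)))" by (rule lam_mono[OF closure_subset])
      also have "\<dots> \<le> inner_content G"
        using \<open>closure (W m) \<subseteq> G\<close> by (intro lam_le_inner closed_imp_compact_space) auto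
      finally show "ennreal (\<phi> L) \<le> inner_content G" .
    qed
  qed
  moreover have "extension \<in> inv_measures h"
    by (rule extension_invariant[OF fa]) (simp add: \<phi>_inv)
  ultimately show False
    using less[of extension] C U by (simp add: emeasure_extension outer_open not_le[symmetric])
qed

text \<open>An orbit has infinitely many distinct points, all of the same mass.\<close>

lemma singleton_null:
  assumes "\<mu> \<in> inv_measures h"
  shows "emeasure \<mu> {x} = 0"
proof -
  have \<mu>: "sets \<mu> = sets borel" "prob_space \<mu>"
    "\<And>A. A \<in> sets borel \<Longrightarrow> emeasure \<mu> (h -` A) = emeasure \<mu> A"
    using assms by (auto simp: inv_measures_def)
  interpret prob_space \<mu> by fact
  have "inj h" using bij by (simp add: bij_def)
  then have "h -` {h y} = {y}" for y by (auto simp: inj_def)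
  then have step: "measure \<mu> {h y} = measure \<mu> {y}" for y
    using \<mu>(3)[of "{h y}"] by (simp add: measure_def)
  have eq: "measure \<mu> {T (int i) x} = measure \<mu> {x}" for i
  proof (induction i)
    case (Suc i)
    then show ?case using T_succ[of "int i" x] step by (simp add: add.commute)
  qed simp
  have "real n * measure \<mu> {x} \<le> 1" for n
  proof -
    have inj: "inj_on (\<lambda>i. T (int i) x) {..<n}" by (simp add: inj_on_def T_eq_iff)
    have "measure \<mu> ((\<lambda>i. T (int i) x) ` {..<n}) = (\<Sum>y\<in>(\<lambda>i. T (int i) x) ` {..<n}. measure \<mu> {y})"
      by (rule finite_measure_eq_sum_singleton) (auto simp: \<mu>(1))
    also have "\<dots> = real n * measure \<mu> {x}"
      by (simp add: sum.reindex[OF inj] eq)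
    finally show ?thesis using prob_le_1[of "(\<lambda>i. T (int i) x) ` {..<n}"] by simp
  qed
  then have "measure \<mu> {x} = 0"
    using reals_Archimedean3[of "measure \<mu> {x}"] by (metis measure_nonneg linorder_not_le less_eq_real_def)
  then show ?thesis by (simp add: emeasure_eq_measure)
qed

subsection \<open>Matching along orbit blocks\<close>

text \<open>Away from the listed frontiers the finite itinerary is constant near \<open>x\<close>,
  and with it membership in \<open>E\<close>.\<close>

lemma frontier_local:
  assumes "finite I" "finite \<S>"
    and loc: "\<And>x y. (\<And>i S. i \<in> I \<Longrightarrow> S \<in> \<S> \<Longrightarrow> T i x \<in> S \<longleftrightarrow> T i y \<in> S) \<Longrightarrow> x \<in> E \<Longrightarrow> y \<in> E"
  shows "frontier E \<subseteq> (\<Union>i\<in>I. \<Union>S\<in>\<S>. T i -` frontier S)"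
proof
  fix x assume x: "x \<in> frontier E"
  show "x \<in> (\<Union>i\<in>I. \<Union>S\<in>\<S>. T i -` frontier S)"
  proof (rule ccontr)
    assume *: "\<not> ?thesis"
    have "\<forall>\<^sub>F y in nhds x. T i y \<in> S \<longleftrightarrow> T i x \<in> S" if "i \<in> I" "S \<in> \<S>" for i S
    proof -
      have "\<forall>\<^sub>F z in nhds (T i x). z \<in> S \<longleftrightarrow> T i x \<in> S"
        using * that notin_frontier_iff[of "T i x" S] by blast
      moreover have "filterlim (T i) (nhds (T i x)) (nhds x)"
        using continuous_T[of i] by (simp add: continuous_on_eq_continuous_at tendsto_at_iff_tendsto_nhds isCont_def)
      ultimately show ?thesis by (rule eventually_compose_filterlim)
    qed
    then have "\<forall>\<^sub>F y in nhds x. \<forall>i\<in>I. \<forall>S\<in>\<S>. T i y \<in> S \<longleftrightarrow> T i x \<in> S"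
      using assms(1,2) by (simp add: eventually_ball_finite)
    then have "\<forall>\<^sub>F y in nhds x. y \<in> E \<longleftrightarrow> x \<in> E"
      by eventually_elim (use loc in blast)
    then show False using x notin_frontier_iff by blast
  qed
qed

text \<open>Cut each orbit into the blocks between consecutive visits to \<open>Y\<close>.  Inside a block the point
  of \<open>A\<close> of rank \<open>r\<close> (at height \<open>k\<close>) is matched with the point of \<open>B\<close> of rank \<open>r\<close> (at height \<open>t\<close>);
  \<open>matched A B Y R d\<close> is the part of \<open>A\<close> whose partner is its \<open>d\<close>-th translate.\<close>

definition matched :: "'a set \<Rightarrow> 'a set \<Rightarrow> 'a set \<Rightarrow> nat \<Rightarrow> int \<Rightarrow> 'a set" where
  "matched A B Y R d = {x. \<exists>k\<le>R. \<exists>t\<le>R. d = int t - int k \<and> x \<in> A \<and> T (- int k) x \<in> Y \<and>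
     (\<forall>j. 0 < j \<longrightarrow> j \<le> max k t \<longrightarrow> T (int j - int k) x \<notin> Y) \<and> T (int t - int k) x \<in> B \<and>
     card {i. i < t \<and> T (int i - int k) x \<in> B} = card {i. i < k \<and> T (int i - int k) x \<in> A}}"

text \<open>The common image determines its block, which starts at the last visit to
  \<open>Y\<close> up to that point, and hence its own rank in \<open>B\<close>; this rank recovers
  the height of the preimage.\<close>

lemma matched_disjoint:
  assumes "d \<noteq> e"
  shows "T d ` matched A B Y R d \<inter> T e ` matched A B Y R e = {}"
proof (rule ccontr)
  assume "\<not> ?thesis"
  then obtain x x' where x: "x \<in> matched A B Y R d" "x' \<in> matched A B Y R e" "T d x = T e x'" by blast
  obtain k t where kt: "d = int t - int k" "x \<in> A" "T (- int k) x \<in> Y"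
    "\<And>j. 0 < j \<Longrightarrow> j \<le> max k t \<Longrightarrow> T (int j - int k) x \<notin> Y"
    "card {i. i < t \<and> T (int i - int k) x \<in> B} = card {i. i < k \<and> T (int i - int k) x \<in> A}"
    using x(1) unfolding matched_def by blast
  obtain k' t' where kt': "e = int t' - int k'" "x' \<in> A" "T (- int k') x' \<in> Y"
    "\<And>j. 0 < j \<Longrightarrow> j \<le> max k' t' \<Longrightarrow> T (int j - int k') x' \<notin> Y"
    "card {i. i < t' \<and> T (int i - int k') x' \<in> B} = card {i. i < k' \<and> T (int i - int k') x' \<in> A}"
    using x(2) unfolding matched_def by blast
  define y where "y = T (- int k) x"
  define y' where "y' = T (- int k') x'"
  have T_y: "T (int j - int k) x = T (int j) y" "T (int j - int k') x' = T (int j) y'" for j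
    by (simp_all add: y_def y'_def T_T)
  have x_y: "x = T (int k) y" "x' = T (int k') y'" by (simp_all add: y_def y'_def T_T)
  have eq: "T (int t) y = T (int t') y'" using x(3) kt(1) kt'(1) T_y by metis
  \<comment> \<open>If the heights differed, the base of one block would be a forbidden visit to
    \<open>Y\<close> inside the other.\<close>
  have "t = t'"
  proof (cases t t' rule: linorder_cases)
    case less
    have "y = T (- int t) (T (int t') y')" using eq by (metis T_neg_cancel(1))
    also have "\<dots> = T (int (t' - t)) y'" using less by (simp add: T_T of_nat_diff)
    finally have "T (int (t' - t)) y' \<in> Y" using kt(3) by (simp add: y_def)
    then show ?thesis using kt'(4)[of "t' - t"] less unfolding T_y by (simp add: le_max_iff_disj)
  next
    case greater
    have "y' = T (- int t') (T (int t) y)" using eq by (metis T_neg_cancel(1))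
    also have "\<dots> = T (int (t - t')) y" using greater by (simp add: T_T of_nat_diff)
    finally have "T (int (t - t')) y \<in> Y" using kt'(3) by (simp add: y'_def)
    then show ?thesis using kt(4)[of "t - t'"] greater unfolding T_y by (simp add: le_max_iff_disj)
  qed
  then have "y = y'" using eq by (simp add: inj_T)
  have "k = k'"
  proof (rule rank_inj[where P = "\<lambda>i. T (int i) y \<in> A"])
    show "T (int k) y \<in> A" using kt(2) x_y(1) by simp
    show "T (int k') y \<in> A" using kt'(2) x_y(2) \<open>y = y'\<close> by simp
    show "visits A k y = visits A k' y"
      using kt(5) kt'(5) \<open>t = t'\<close> \<open>y = y'\<close> unfolding T_y by simp
  qed
  then show False using assms kt(1) kt'(1) \<open>t = t'\<close> by simp
qed

lemma matched_image: "T d ` matched A B Y R d \<subseteq> B"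
  unfolding matched_def by auto

lemma matched_empty: "matched A B Y R d \<noteq> {} \<Longrightarrow> d \<in> {- int R..int R}"
  unfolding matched_def by auto

text \<open>The block through \<open>x\<close> has length at least \<open>N\<close>, so it contains
  at least as many points of \<open>B\<close> as of \<open>A\<close>, and the rank of
  \<open>x\<close> also occurs in \<open>B\<close>.\<close>

lemma matched_cover:
  assumes hits: "\<And>x. \<exists>i\<le>R. T (int i) x \<in> Y"
    and return: "\<And>y i. y \<in> Y \<Longrightarrow> 0 < i \<Longrightarrow> i < N \<Longrightarrow> T (int i) y \<notin> Y"
    and visits: "\<And>n x. n \<ge> N \<Longrightarrow> visits A n x \<le> visits B n x"
  shows "A \<subseteq> (\<Union>d. matched A B Y R d)"
proof
  fix x assume "x \<in> A"
  obtain k0 where k0: "k0 \<le> R" "T (- int k0) x \<in> Y"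
  proof -
    obtain i where i: "i \<le> R" "T (int i) (T (- int R) x) \<in> Y" using hits by blast
    then have "T (- int (R - i)) x \<in> Y" by (simp add: T_T of_nat_diff)
    then show ?thesis using that[of "R - i"] by simp
  qed
  define k where "k = (LEAST k. T (- int k) x \<in> Y)"
  define y where "y = T (- int k) x"
  have k: "y \<in> Y" "k \<le> R" unfolding y_def k_def using k0
    by (auto intro: LeastI order_trans[OF Least_le])
  have T_y: "T (int j - int k) x = T (int j) y" for j by (simp add: y_def T_T)
  have k_free: "T (int j) y \<notin> Y" if "0 < j" "j \<le> k" for j
  proof -
    have "T (- int (k - j)) x \<notin> Y" unfolding k_def by (rule not_less_Least) (use that in \<open>auto simp: k_def\<close>)
    then show ?thesis using that by (simp add: y_def T_T of_nat_diff)
  qed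
  \<comment> \<open>The search starts at \<open>T 1 y\<close>, so the return time is bounded by
    \<open>Suc R\<close>; heights in the block lie below it and are at most
    \<open>R\<close>.\<close>
  obtain n0 where n0: "0 < n0" "n0 \<le> Suc R" "T (int n0) y \<in> Y"
  proof -
    obtain i where i: "i \<le> R" "T (int i) (T 1 y) \<in> Y" using hits by blast
    then have "T (int (Suc i)) y \<in> Y" by (simp only: T_T of_nat_Suc add.commute)
    then show ?thesis using that[of "Suc i"] i by simp
  qed
  define n where "n = (LEAST n. 0 < n \<and> T (int n) y \<in> Y)"
  have n: "0 < n" "T (int n) y \<in> Y" "n \<le> Suc R"
    using LeastI[of "\<lambda>n. 0 < n \<and> T (int n) y \<in> Y" n0] Least_le[of "\<lambda>n. 0 < n \<and> T (int n) y \<in> Y" n0] n0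
    by (auto simp: n_def)
  have n_free: "T (int j) y \<notin> Y" if "0 < j" "j < n" for j
    using not_less_Least[of j "\<lambda>n. 0 < n \<and> T (int n) y \<in> Y"] that by (auto simp: n_def)
  have "N \<le> n" using return[OF k(1) n(1)] n(2) by (meson not_less)
  have "k < n" using k_free[OF n(1)] n(2) by (meson not_less)
  \<comment> \<open>Height \<open>k\<close> belongs to \<open>x\<close> itself and is counted only
    on the right; \<open>rank_attained\<close> needs this strictness.\<close>
  have "visits A k y < visits A n y"
  proof (rule psubset_card_mono)
    have "T (int k) y \<in> A" using \<open>x \<in> A\<close> by (simp add: y_def)
    then show "{i. i < k \<and> T (int i) y \<in> A} \<subset> {i. i < n \<and> T (int i) y \<in> A}"
      using \<open>k < n\<close> by auto
  qed simp
  also have "\<dots> \<le> visits B n y" using visits[OF \<open>N \<le> n\<close>] .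
  finally obtain t where t: "t < n" "T (int t) y \<in> B" "visits B t y = visits A k y"
    by (rule rank_attained)
  have "T (int j) y \<notin> Y" if "0 < j" "j \<le> max k t" for j
    using n_free[OF that(1)] that(2) \<open>k < n\<close> t(1) by auto
  moreover have "t \<le> R" using t(1) n(3) by simp
  ultimately have "x \<in> matched A B Y R (int t - int k)"
    unfolding matched_def mem_Collect_eq
    by (intro exI[of _ k] exI[of _ t]) (use k \<open>x \<in> A\<close> t in \<open>simp add: T_y flip: y_def\<close>)
  then show "x \<in> (\<Union>d. matched A B Y R d)" by blast
qed

text \<open>Every power that occurs is a difference of two heights, both at most
  \<open>R\<close>.\<close>

lemma matched_local:
  assumes "\<And>i S. i \<in> {- int R..int R} \<Longrightarrow> S \<in> {A, B, Y} \<Longrightarrow> T i x \<in> S \<longleftrightarrow> T i z \<in> S"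
    and "x \<in> matched A B Y R d"
  shows "z \<in> matched A B Y R d"
proof -
  obtain k t where kt: "k \<le> R" "t \<le> R" "d = int t - int k" "x \<in> A" "T (- int k) x \<in> Y"
    "\<And>j. 0 < j \<Longrightarrow> j \<le> max k t \<Longrightarrow> T (int j - int k) x \<notin> Y" "T (int t - int k) x \<in> B"
    "card {i. i < t \<and> T (int i - int k) x \<in> B} = card {i. i < k \<and> T (int i - int k) x \<in> A}"
    using assms(2) unfolding matched_def by blast
  have same: "T (int i - int k) x \<in> S \<longleftrightarrow> T (int i - int k) z \<in> S" if "i \<le> R" "S \<in> {A, B, Y}" for i S
    using assms(1)[of "int i - int k" S] that kt(1) by auto
  have "{i. i < t \<and> T (int i - int k) x \<in> B} = {i. i < t \<and> T (int i - int k) z \<in> B}"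
    using same[of _ B] kt(2) by auto
  moreover have "{i. i < k \<and> T (int i - int k) x \<in> A} = {i. i < k \<and> T (int i - int k) z \<in> A}"
    using same[of _ A] kt(1) by auto
  moreover have "z \<in> A" using same[of k A] kt(1,4) by simp
  moreover have "T (- int k) z \<in> Y" using same[of 0 Y] kt(5) by simp
  moreover have "T (int t - int k) z \<in> B" using same[of t B] kt(2,7) by simp
  moreover have "T (int j - int k) z \<notin> Y" if "0 < j" "j \<le> max k t" for j
    using same[of j Y] kt(6)[OF that] that kt(1,2) by auto
  ultimately show ?thesis unfolding matched_def using kt(1,2,3,8) by auto
qed

subsection \<open>Comparison\<close>

lemma small_frontier_neighbourhood:
  assumes "top_small_boundary_property h" "closed F" "open G" "F \<subseteq> G"
  obtains A m where "open A" "F \<subseteq> A" "closure A \<subseteq> G" "small m (frontier A)"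
proof -
  have "compact F \<and> compact (- G) \<and> F \<inter> - G = {}"
    using assms by (auto intro!: closed_imp_compact_space)
  then obtain A V where AV: "open A" "F \<subseteq> A" "- G \<subseteq> V" "closure A \<inter> closure V = {}" "top_small h (frontier A)"
    using assms(1)[unfolded top_small_boundary_property_def, rule_format, of F "- G"] by blast
  have "- G \<subseteq> closure V" using AV(3) closure_subset by (rule order_trans)
  then have "closure A \<subseteq> G" using AV(4) by blast
  moreover obtain m where "small m (frontier A)" using top_small_imp_small[OF AV(5)] by blast
  ultimately show ?thesis using that AV(1,2) by blast
qed

text \<open>The iterates of \<open>u\<close> at times strictly between \<open>0\<close> and
  \<open>N\<close> differ from \<open>u\<close>; open sets separating them from \<open>u\<close> are
  pulled back and intersected.\<close>

lemma long_return_neighbourhood: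
  obtains G where "open G" "u \<in> G" "\<And>y i. y \<in> G \<Longrightarrow> 0 < i \<Longrightarrow> i < (N :: nat) \<Longrightarrow> T (int i) y \<notin> G"
proof -
  have "\<exists>P Q. open P \<and> open Q \<and> u \<in> P \<and> T (int i) u \<in> Q \<and> P \<inter> Q = {}" if "0 < i" for i :: nat
  proof -
    have "u \<noteq> T (int i) u" using aperiodic[of "int i" u] that by auto
    then show ?thesis by (rule hausdorff)
  qed
  then obtain P Q where PQ: "\<And>i. 0 < i \<Longrightarrow> open (P i) \<and> open (Q i) \<and> u \<in> P i \<and> T (int i) u \<in> Q i \<and> P i \<inter> Q i = {}"
    by metis
  define G where "G = (\<Inter>i\<in>{0<..<N}. P i \<inter> T (int i) -` Q i)"
  show ?thesis
  proof (rule that[of G])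
    show "open G" unfolding G_def using PQ by (intro open_INT ballI open_Int open_T_vimage) auto
    show "u \<in> G" using PQ by (simp add: G_def)
    fix y and i :: nat assume *: "y \<in> G" "0 < i" "i < N"
    then have "T (int i) y \<in> Q i" by (simp add: G_def)
    then have "T (int i) y \<notin> P i" using PQ[OF *(2)] by blast
    then show "T (int i) y \<notin> G" using * by (auto simp: G_def)
  qed
qed

lemma comparison:
  assumes sbp: "top_small_boundary_property h" and C: "closed C" and U: "open U"
    and less: "\<And>\<mu>. \<mu> \<in> inv_measures h \<Longrightarrow> emeasure \<mu> C < emeasure \<mu> U"
  shows "subequiv C U"
proof -
  \<comment> \<open>For empty \<open>U\<close> the hypothesis would merely say that there is no
    invariant measure; the windows rule this out, as no count is below zero.\<close>
  have "U \<noteq> {}"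
  proof
    assume "U = {}"
    obtain W K N where "K \<subseteq> U" and *: "\<forall>n\<ge>N. \<forall>x. visits W n x < visits K n x"
      using window_comparison[OF C U less] by blast
    then have "K = {}" using \<open>U = {}\<close> by blast
    with * have "visits W N undefined < visits {} N undefined" by blast
    then show False by simp
  qed
  then obtain u where u: "u \<in> U" by blast
  text \<open>Invariant measures do not charge points, so a point of \<open>U\<close> can be set aside: a neighbourhood
    of it receives the boundaries of the pieces.\<close>
  have "open (U - {u})" using U by (simp add: open_Diff)
  have "emeasure \<mu> C < emeasure \<mu> (U - {u})" if \<mu>: "\<mu> \<in> inv_measures h" for \<mu>
  proof -
    have "sets \<mu> = sets borel" using \<mu> by (simp add: inv_measures_def)
    then have "{u} \<in> null_sets \<mu>" "U \<in> sets \<mu>"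
      using singleton_null[OF \<mu>] U by (auto simp: null_sets_def)
    then show ?thesis using less[OF \<mu>] by (simp add: emeasure_Diff_null_set)
  qed
  from window_comparison[OF C \<open>open (U - {u})\<close> this] obtain W K N where
    WK: "open W" "C \<subseteq> W" "closed K" "K \<subseteq> U - {u}" and
    visits: "\<And>n x. n \<ge> N \<Longrightarrow> visits W n x < visits K n x"
    by blast
  obtain A mA where A: "open A" "C \<subseteq> A" "closure A \<subseteq> W" "small mA (frontier A)"
    using small_frontier_neighbourhood[OF sbp C WK(1,2)] .
  obtain B mB where B: "open B" "K \<subseteq> B" "closure B \<subseteq> U - {u}" "small mB (frontier B)"
    using small_frontier_neighbourhood[OF sbp WK(3) \<open>open (U - {u})\<close> WK(4)] .
  have AB: "visits A n x \<le> visits B n x" if "n \<ge> N" for n x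
  proof -
    have "A \<subseteq> W" using A(3) closure_subset by blast
    then have "visits A n x \<le> visits W n x" by (rule visits_mono)
    also have "\<dots> < visits K n x" by (rule visits[OF that])
    also have "\<dots> \<le> visits B n x" by (rule visits_mono[OF B(2)])
    finally show ?thesis by simp
  qed
  obtain G where G: "open G" "u \<in> G" "\<And>y i. y \<in> G \<Longrightarrow> 0 < i \<Longrightarrow> i < N \<Longrightarrow> T (int i) y \<notin> G"
    using long_return_neighbourhood[of u N] by blast
  obtain Y mY where Y: "open Y" "{u} \<subseteq> Y" "closure Y \<subseteq> G" "small mY (frontier Y)"
    using small_frontier_neighbourhood[OF sbp _ G(1), of "{u}"] G(2) by auto
  have "Y \<subseteq> G" using Y(3) closure_subset by blast
  then have return: "T (int i) y \<notin> Y" if "y \<in> Y" "0 < i" "i < N" for y i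
    using G(3) that by blast
  have "Y \<noteq> {}" using Y(2) by blast
  then obtain R where R: "\<And>x. \<exists>i\<le>R. T (int i) x \<in> Y" using hits_open[OF Y(1)] by blast
  define M where "M = matched A B Y R"
  define F where "F = (\<Union>i\<in>{- int R..int R}. \<Union>S\<in>{A, B, Y}. T i -` frontier S)"
  have "frontier (M d) \<subseteq> F" for d
    unfolding F_def M_def by (rule frontier_local[OF _ _ matched_local]) simp_all
  have "closed F" unfolding F_def by (intro closed_UN ballI closed_T_vimage) auto
  moreover have "\<exists>m. small m F" unfolding F_def
    by (intro small_UN) (use A(4) B(4) Y(4) small_T_vimage in blast)+
  ultimately have "thin F" using small_imp_thin by blast
  \<comment> \<open>This is the room kept around \<open>u\<close>: disjoint from \<open>B\<close>,
    and nonempty because the closure of \<open>B\<close> misses \<open>u\<close>.\<close>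
  define V where "V = U - closure B"
  have "open V" "u \<in> V" using U u B(3) by (auto simp: V_def)
  then have "subequiv F V" using \<open>thin F\<close> unfolding thin_def by blast
  then obtain Q where Q: "\<And>d. open (Q d)" "F \<subseteq> (\<Union>d. Q d)" "\<And>d. T d ` closure (Q d) \<subseteq> V"
    "\<And>d e. d \<noteq> e \<Longrightarrow> T d ` closure (Q d) \<inter> T e ` closure (Q e) = {}"
    "finite {d. Q d \<noteq> {}}"
    using subequiv_openE[OF _ \<open>open V\<close>] by blast
  \<comment> \<open>\<open>M d\<close> need not be closed, but its closure adds only frontier
    points. These lie in \<open>F\<close> and are covered by the sets \<open>Q d\<close>, so the
    remainder is closed and still inside \<open>M d\<close>.\<close>
  define L where "L d = closure (M d) - (\<Union>d. Q d)" for d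
  have L_M: "L d \<subseteq> M d" for d
  proof -
    have "closure (M d) \<subseteq> M d \<union> frontier (M d)"
      by (metis closure_Un_frontier order_refl)
    then show ?thesis using \<open>frontier (M d) \<subseteq> F\<close> Q(2) unfolding L_def by blast
  qed
  have "subequiv (\<Union>d. L d) B" unfolding subequiv_def
  proof (intro exI[of _ L] conjI allI impI)
    have "{d. L d \<noteq> {}} \<subseteq> {- int R..int R}"
      using L_M matched_empty unfolding M_def by blast
    then show "finite {d. L d \<noteq> {}}" using finite_subset by blast
    show "closed (L d)" for d unfolding L_def using Q(1) by (intro closed_Diff open_UN) auto
    show "T d ` L d \<subseteq> B" for d
      using image_mono[OF L_M] matched_image unfolding M_def by (rule order_trans)
    show "T d ` L d \<inter> T e ` L e = {}" if "d \<noteq> e" for d e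
      by (rule disjoint_subsets[OF image_mono[OF L_M] image_mono[OF L_M]])
        (simp add: M_def matched_disjoint[OF that])
  qed simp
  moreover have "subequiv (\<Union>d. Q d) V" unfolding subequiv_def
  proof (intro exI[of _ "\<lambda>d. closure (Q d)"] conjI allI impI)
    show "finite {d. closure (Q d) \<noteq> {}}" using Q(5) by simp
    show "(\<Union>d. Q d) \<subseteq> (\<Union>d. closure (Q d))" by (intro UN_mono closure_subset order_refl)
  qed (use Q in auto)
  moreover have "B \<inter> V = {}" using closure_subset[of B] by (auto simp: V_def)
  ultimately have "subequiv ((\<Union>d. L d) \<union> (\<Union>d. Q d)) (B \<union> V)" by (rule subequiv_Un)
  then show ?thesis
  proof (rule subequiv_mono)
    have "A \<subseteq> (\<Union>d. M d)" unfolding M_def by (rule matched_cover[OF R return AB])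
    also have "\<dots> \<subseteq> (\<Union>d. L d) \<union> (\<Union>d. Q d)" unfolding L_def using closure_subset by blast
    finally show "C \<subseteq> (\<Union>d. L d) \<union> (\<Union>d. Q d)" using A(2) by blast
    show "B \<union> V \<subseteq> U" using B(3) closure_subset[of B] by (auto simp: V_def)
  qed
qed

section \<open>From closed pieces to a partition of unity\<close>

lemma subequiv_partition:
  assumes "subequiv C U" "open U"
  obtains f :: "nat \<Rightarrow> 'a \<Rightarrow> real" and M :: nat and d :: "nat \<Rightarrow> int"
  where "\<And>j. continuous_on UNIV (f j)" "\<And>j x. 0 \<le> f j x \<and> f j x \<le> 1"
    "\<And>x. x \<in> C \<Longrightarrow> (\<Sum>j\<le>M. f j x) = 1"
    "\<And>j. j \<le> M \<Longrightarrow> supp_fun (f j \<circ> T (- d j)) \<subseteq> U"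
    "\<And>j k. j \<le> M \<Longrightarrow> k \<le> M \<Longrightarrow> j \<noteq> k \<Longrightarrow>
       supp_fun (f j \<circ> T (- d j)) \<inter> supp_fun (f k \<circ> T (- d k)) = {}"
proof -
  obtain K where K: "finite {d. K d \<noteq> {}}" "\<And>d. closed (K d)" "\<And>d. T d ` K d \<subseteq> U"
    "\<And>d e. d \<noteq> e \<Longrightarrow> T d ` K d \<inter> T e ` K e = {}" "C \<subseteq> (\<Union>d. K d)"
    using assms(1) unfolding subequiv_def by blast
  obtain W where W: "\<And>d. open (W d)" "\<And>d. K d \<subseteq> W d" "\<And>d. T d ` closure (W d) \<subseteq> U"
    "\<And>d e. d \<noteq> e \<Longrightarrow> T d ` closure (W d) \<inter> T e ` closure (W e) = {}"
    "finite {d. W d \<noteq> {}}"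
    using open_enlargement[OF K(1-4) assms(2)] by blast
  have "\<exists>g :: 'a \<Rightarrow> real. continuous_on UNIV g \<and> range g \<subseteq> {0..1} \<and> g ` (- W d) \<subseteq> {0} \<and> g ` K d \<subseteq> {1}" for d
  proof -
    have "normal_space (euclidean :: 'a topology)"
      by (simp add: metrizable_imp_normal_space metrizable_space_euclidean)
    moreover have "closedin euclidean (- W d)" "closedin euclidean (K d)" "disjnt (- W d) (K d)"
      using W(1,2) K(2) by (auto simp: disjnt_def)
    ultimately obtain g where "continuous_map euclidean (top_of_set {0..1::real}) g"
      "g ` (- W d) \<subseteq> {0}" "g ` K d \<subseteq> {1}"
      using Urysohn_lemma[of euclidean "- W d" "K d" 0 1] by auto
    then show ?thesis by (auto simp: continuous_map_in_subtopology intro!: exI[of _ g])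
  qed
  then obtain g :: "int \<Rightarrow> 'a \<Rightarrow> real" where g: "\<And>d. continuous_on UNIV (g d)"
    "\<And>d. range (g d) \<subseteq> {0..1}" "\<And>d. g d ` (- W d) \<subseteq> {0}" "\<And>d. g d ` K d \<subseteq> {1}"
    by metis
  have g01: "0 \<le> g d x" "g d x \<le> 1" for d x using subsetD[OF g(2) rangeI, of d x] by auto
  \<comment> \<open>The index \<open>0\<close> keeps \<open>D\<close> nonempty, so that
    \<open>{..M}\<close> can enumerate it even if all pieces are empty.\<close>
  define D where "D = insert 0 {d. K d \<noteq> {}}"
  have D: "finite D" "D \<noteq> {}" using K(1) by (auto simp: D_def)
  define M where "M = card D - 1"
  have "{0..<card D} = {..M}" using D card_gt_0_iff[of D] by (auto simp: M_def)
  then obtain e where e: "bij_betw e {..M} D"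
    using ex_bij_betw_nat_finite[OF D(1)] by metis
  define s where "s x = (\<Sum>d\<in>D. g d x)" for x
  \<comment> \<open>On every \<open>K d\<close> the sum \<open>s\<close> is at least
    \<open>1\<close>, so there this is division by \<open>s\<close>; the maximum gives a continuous
    denominator of at least \<open>1\<close> on the whole space.\<close>
  define f where "f j x = g (e j) x / max 1 (s x)" for j x
  have supp: "supp_fun (f j \<circ> T (- e j)) \<subseteq> T (e j) ` closure (W (e j))" for j
    unfolding supp_fun_def
  proof (rule closure_minimal)
    show "closed (T (e j) ` closure (W (e j)))" by (simp add: closed_T_image)
    show "{x. (f j \<circ> T (- e j)) x \<noteq> 0} \<subseteq> T (e j) ` closure (W (e j))"
    proof
      fix x assume "x \<in> {x. (f j \<circ> T (- e j)) x \<noteq> 0}"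
      then have "g (e j) (T (- e j) x) \<noteq> 0" by (auto simp: f_def)
      then have "T (- e j) x \<in> W (e j)" using g(3)[of "e j"] by blast
      then show "x \<in> T (e j) ` closure (W (e j))"
        using closure_subset[of "W (e j)"] by (auto simp: T_image_iff)
    qed
  qed
  show ?thesis
  proof (rule that[of f M e])
    show "continuous_on UNIV (f j)" for j
      unfolding f_def s_def by (intro continuous_intros g(1)) (auto simp: max_def)
    show "0 \<le> f j x \<and> f j x \<le> 1" for j x
      using g01[of "e j" x] by (auto simp: f_def divide_le_eq)
    show "(\<Sum>j\<le>M. f j x) = 1" if "x \<in> C" for x
    proof -
      obtain d where d: "x \<in> K d" using K(5) \<open>x \<in> C\<close> by blast
      have "g d x = 1" using g(4) d by blast
      moreover have "d \<in> D" using d by (auto simp: D_def)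
      ultimately have "1 \<le> s x"
        unfolding s_def using member_le_sum[of d D "\<lambda>d. g d x"] g01 D(1) by auto
      moreover have "(\<Sum>j\<le>M. g (e j) x) = s x"
        unfolding s_def by (rule sum.reindex_bij_betw[OF e])
      ultimately show ?thesis
        unfolding f_def by (simp flip: sum_divide_distrib)
    qed
    show "supp_fun (f j \<circ> T (- e j)) \<subseteq> U" for j
      using supp W(3) by (rule order_trans)
    show "supp_fun (f j \<circ> T (- e j)) \<inter> supp_fun (f k \<circ> T (- e k)) = {}"
      if "j \<le> M" "k \<le> M" "j \<noteq> k" for j k
    proof -
      have "e j \<noteq> e k" using e that by (auto simp: bij_betw_def inj_on_def)
      then show ?thesis by (rule disjoint_subsets[OF supp supp W(4)])
    qed
  qed
qed

end

theorem theorem5p6: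
  fixes h :: "'a::metric_space \<Rightarrow> 'a"
  assumes "compact (UNIV :: 'a set)"
    and "infinite (UNIV :: 'a set)"
    and "\<exists>g. homeomorphism UNIV UNIV h g"
    and "minimal_hom h"
    and "top_small_boundary_property h"
  shows "dynamic_comparison_property h"
proof -
  obtain g where g: "homeomorphism UNIV UNIV h g" using assms(3) by blast
  then have "bij h" unfolding homeomorphism_def by (intro o_bij[of g]) (auto simp: fun_eq_iff)
  have "inv h = g" using g unfolding homeomorphism_def by (intro inv_equality) auto
  interpret minimal_system h
    by unfold_locales (use assms \<open>bij h\<close> \<open>inv h = g\<close> g in \<open>auto simp: homeomorphism_def\<close>)
  show ?thesis unfolding dynamic_comparison_property_def
  proof (intro allI impI, elim conjE)
    fix U C :: "'a set"
    assume "open U" "closed C" "\<forall>\<mu>\<in>inv_measures h. emeasure \<mu> C < emeasure \<mu> U"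
    then have "subequiv C U" using comparison[OF assms(5)] by blast
    show "\<exists>(M::nat) (f::nat \<Rightarrow> 'a \<Rightarrow> real) (d::nat \<Rightarrow> int).
            (\<forall>j\<le>M. continuous_on UNIV (f j) \<and> (\<forall>x. 0 \<le> f j x \<and> f j x \<le> 1)) \<and>
            (\<forall>x\<in>C. (\<Sum>j\<le>M. f j x) = 1) \<and>
            (\<forall>j\<le>M. supp_fun (f j \<circ> hpow h (- d j)) \<subseteq> U) \<and>
            (\<forall>j\<le>M. \<forall>k\<le>M. j \<noteq> k \<longrightarrow>
               supp_fun (f j \<circ> hpow h (- d j)) \<inter> supp_fun (f k \<circ> hpow h (- d k)) = {})"
    proof (rule subequiv_partition[OF \<open>subequiv C U\<close> \<open>open U\<close>], goal_cases)
      case (1 f M d)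
      then show ?case by (intro exI[of _ M] exI[of _ f] exI[of _ d]) auto
    qed
  qed
qed

end
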